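(* Suppose the ellipticity assumption stated in the context holds on $U$. (i) Assume $|b(x)|\le M_2$ for all $x\in U$ with a constant $M_2\ge0$. There exist constants $C_*>0$ and $\nu>0$ (independent of $u_1,u_2$) such that if $u_1,u_2\in C^2(U)\cap C(\widetilde U)$ satisfy $Lu_1=Lu_2$ in $U$, $u_1=u_2$ on $\gamma$, and are below exponential growth in $\widetilde U$, then $$\sup_{x\in U} |u_1(x)-u_2(x)|\le \max_{x\in \mathcal S_{\theta_0}}|u_1(x)-u_2(x)|,$$ $$\max_{x\in \mathcal S_{\theta}} |u_1(x)-u_2(x)|\le C_*\Big(\max_{x\in \mathcal S_{\theta_0}}|u_1(x)-u_2(x)| \Big)e^{-\nu(\theta-\theta_0)}\quad\text{for all }\theta\ge\theta_0.$$ (ii) Assume the unbounded-drift assumption (with data $\bar\Theta$, $m$, $\kappa$) stated in the context. There exist numbers $\Theta_0\ge\bar\Theta$ and $\bar\nu>0$ (independent of $u_1,u_2$) such that if $u_1,u_2\in C^2(U)\cap C(\widetilde U)$ satisfy $Lu_1=Lu_2$ in $U$, $u_1=u_2$ on $\gamma$, and are bounded in $\widetilde U$, then for all $\theta\ge\theta_0$ $$\max_{x\in \mathcal S_{\theta}}|u_1(x)-u_2(x)|\le \Big(\max_{x\in \mathcal S_{\theta_0}}|u_1(x)-u_2(x)|\Big) \min\left\{1,\exp\left( -\bar\nu\int_{\Theta_0}^\theta \kappa^{m(\zeta)}\, d\zeta\right)\right\}$$ (for $\theta<\Theta_0$ the minimum is understood to be $1$).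
   Context: Domain. Let $X(r,\theta)=(r\cos\theta,r\sin\theta)$ for $r\ge0$, $\theta\in\mathbb R$. Fix $\theta_0\in\mathbb R$ and positive continuous functions $r_1,r_2$ on $[\theta_0,\infty)$ with $r_2(\theta+2\pi)<r_1(\theta)<r_2(\theta)$ for all $\theta\ge\theta_0$, and assume there is $r_*>0$ with $\lim_{\theta\to\infty}r_1(\theta)=\lim_{\theta\to\infty}r_2(\theta)=r_*$. Define $U=\{X(r,\theta):\theta>\theta_0,\ r_1(\theta)<r<r_2(\theta)\}$ (open and bounded), $\widetilde U=\{X(r,\theta):\theta\ge\theta_0,\ r_1(\theta)\le r\le r_2(\theta)\}$, $\gamma=\{X(r_i(\theta),\theta):\theta\ge\theta_0,\ i=1,2\}$, $\mathcal S_\theta=\{X(r,\theta): r_1(\theta)\le r\le r_2(\theta)\}$ for $\theta\ge\theta_0$, and $U_I=\{X(r,\theta):\theta\in I,\ r_1(\theta)<r<r_2(\theta)\}$ for $I\subset[\theta_0,\infty)$. Operator. $A=(a_{ij})$ is a function from $U$ to the real symmetric $2\times2$ matrices, $b:U\to\mathbb R^2$, and $Lu=-\sum_{i,j=1}^2 a_{ij}\frac{\partial^2u}{\partial x_i\partial x_j}+b\cdot\nabla u$ for $u\in C^2(U)$. Ellipticity assumption: there are constants $c_0>0$, $M_1>0$ such that $\xi^{\rm T}A(x)\xi\ge c_0|\xi|^2$ and $\mathrm{Tr}(A(x))\le M_1$ for all $x\in U$, $\xi\in\mathbb R^2$. Unbounded-drift assumption: there are a number $\bar\Theta\ge\theta_0$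 and an increasing function $m:[\bar\Theta,\infty)\to[0,\infty)$ such that $b$ is bounded on $U\cap U_{[\theta_0,\bar\Theta]}$; for any $\theta\ge\bar\Theta$, $|b(x)|\le m(\theta)$ for all $x\in U\cap\mathcal S_\theta$; $\lim_{\theta\to\infty}m(\theta)=\infty$; and there is a number $\kappa\in(0,1)$ with $\int_{\bar\Theta}^\infty\kappa^{m(\theta)}\,d\theta=\infty$. A function $u:\widetilde U\to\mathbb R$ is below exponential growth in $\widetilde U$ if for any $\varepsilon>0$, $\lim_{\theta\to\infty}\big(e^{-\varepsilon\theta}\sup_{x\in\mathcal S_\theta}|u(x)|\big)=0$. *)

theory Defs
  imports "HOL-Analysis.Analysis"
begin

definition polar :: "real \<Rightarrow> real \<Rightarrow> real ^ 2" where
  "polar r \<theta> = vector [r * cos \<theta>, r * sin \<theta>]"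

text \<open>In \<open>spiral_sector\<close> the index set \<open>I\<close> is meant to be a subset of \<open>{\<theta>0..}\<close>.\<close>

definition spiral_sector :: "(real \<Rightarrow> real) \<Rightarrow> (real \<Rightarrow> real) \<Rightarrow> real set \<Rightarrow> (real ^ 2) set" where
  "spiral_sector r1 r2 I = {polar r \<theta> | r \<theta>. \<theta> \<in> I \<and> r1 \<theta> < r \<and> r < r2 \<theta>}"

definition spiral_dom :: "real \<Rightarrow> (real \<Rightarrow> real) \<Rightarrow> (real \<Rightarrow> real) \<Rightarrow> (real ^ 2) set" where
  "spiral_dom \<theta>0 r1 r2 = {polar r \<theta> | r \<theta>. \<theta> > \<theta>0 \<and> r1 \<theta> < r \<and> r < r2 \<theta>}"

definition spiral_closed :: "real \<Rightarrow> (real \<Rightarrow> real) \<Rightarrow> (real \<Rightarrow> real) \<Rightarrow> (real ^ 2) set" where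
  "spiral_closed \<theta>0 r1 r2 = {polar r \<theta> | r \<theta>. \<theta> \<ge> \<theta>0 \<and> r1 \<theta> \<le> r \<and> r \<le> r2 \<theta>}"

definition spiral_walls :: "real \<Rightarrow> (real \<Rightarrow> real) \<Rightarrow> (real \<Rightarrow> real) \<Rightarrow> (real ^ 2) set" where
  "spiral_walls \<theta>0 r1 r2 =
     {polar (r1 \<theta>) \<theta> | \<theta>. \<theta> \<ge> \<theta>0} \<union> {polar (r2 \<theta>) \<theta> | \<theta>. \<theta> \<ge> \<theta>0}"

definition slice :: "(real \<Rightarrow> real) \<Rightarrow> (real \<Rightarrow> real) \<Rightarrow> real \<Rightarrow> (real ^ 2) set" where
  "slice r1 r2 \<theta> = {polar r \<theta> | r. r1 \<theta> \<le> r \<and> r \<le> r2 \<theta>}"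

text \<open>
  Slices are compact, so for a continuous function the real supremum over a slice
  is an attained maximum; \<open>SUP\<close> over a slice is used for \<open>max\<close> throughout.
\<close>

lemma compact_slice: "compact (slice r1 r2 \<theta>)"
proof -
  have eq: "slice r1 r2 \<theta> = (\<lambda>r. r *\<^sub>R polar 1 \<theta>) ` {r1 \<theta>..r2 \<theta>}"
    unfolding slice_def polar_def
    by (auto simp: vec_eq_iff forall_2 image_iff intro!: bexI)
  show ?thesis
    unfolding eq by (intro compact_continuous_image continuous_intros compact_Icc)
qed

lemma slice_SUP_attained:
  fixes f :: "real ^ 2 \<Rightarrow> real"
  assumes "continuous_on (slice r1 r2 \<theta>) f" and "r1 \<theta> \<le> r2 \<theta>"
  shows "\<exists>x\<in>slice r1 r2 \<theta>. \<bar>f x\<bar> = (SUP y\<in>slice r1 r2 \<theta>. \<bar>f y\<bar>)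
           \<and> (\<forall>y\<in>slice r1 r2 \<theta>. \<bar>f y\<bar> \<le> \<bar>f x\<bar>)"
proof -
  have ne: "slice r1 r2 \<theta> \<noteq> {}"
    using assms(2) by (auto simp: slice_def)
  have "continuous_on (slice r1 r2 \<theta>) (\<lambda>x. \<bar>f x\<bar>)"
    by (intro continuous_intros assms(1))
  then obtain x where x: "x \<in> slice r1 r2 \<theta>" "\<forall>y\<in>slice r1 r2 \<theta>. \<bar>f y\<bar> \<le> \<bar>f x\<bar>"
    using continuous_attains_sup[OF compact_slice ne] by blast
  have "(SUP y\<in>slice r1 r2 \<theta>. \<bar>f y\<bar>) = \<bar>f x\<bar>"
    by (rule cSup_eq_maximum) (use x in auto)
  with x show ?thesis by metis
qed

definition partial_deriv :: "2 \<Rightarrow> (real ^ 2 \<Rightarrow> real) \<Rightarrow> real ^ 2 \<Rightarrow> real" where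
  "partial_deriv i f x = frechet_derivative f (at x) (axis i 1)"

definition gradient :: "(real ^ 2 \<Rightarrow> real) \<Rightarrow> real ^ 2 \<Rightarrow> real ^ 2" where
  "gradient f x = (\<chi> i. partial_deriv i f x)"

text \<open>
  Intended for open \<open>U\<close>: twice Frechet differentiable with continuous second derivatives
  (continuity of the function and of its first derivatives is then automatic).
\<close>

definition C2_on :: "(real ^ 2) set \<Rightarrow> (real ^ 2 \<Rightarrow> real) \<Rightarrow> bool" where
  "C2_on U u \<longleftrightarrow>
     (\<forall>x\<in>U. u differentiable (at x)) \<and>
     (\<forall>i. \<forall>x\<in>U. partial_deriv i u differentiable (at x)) \<and>
     (\<forall>i j. continuous_on U (partial_deriv i (partial_deriv j u)))"

definition nondiv_op ::
  "(real ^ 2 \<Rightarrow> real ^ 2 ^ 2) \<Rightarrow> (real ^ 2 \<Rightarrow> real ^ 2) \<Rightarrow> (real ^ 2 \<Rightarrow> real) \<Rightarrow> real ^ 2 \<Rightarrow> real" where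
  "nondiv_op A b u x =
     - (\<Sum>i\<in>UNIV. \<Sum>j\<in>UNIV. A x $ i $ j * partial_deriv i (partial_deriv j u) x)
     + b x \<bullet> gradient u x"

definition elliptic_on :: "(real ^ 2) set \<Rightarrow> (real ^ 2 \<Rightarrow> real ^ 2 ^ 2) \<Rightarrow> bool" where
  "elliptic_on U A \<longleftrightarrow>
     (\<exists>c0>0. \<exists>M1>0. \<forall>x\<in>U. (\<forall>\<xi>. \<xi> \<bullet> (A x *v \<xi>) \<ge> c0 * (norm \<xi>)\<^sup>2) \<and> trace (A x) \<le> M1)"

text \<open>
  ``Increasing'' is read as nondecreasing.  Since \<open>\<kappa> powr m \<theta>\<close> is then monotone, it is
  integrable on compact intervals, and divergence of the improper integral of this positive
  function says that its integrals over \<open>{\<Theta>..T}\<close> tend to infinity with \<open>T\<close>.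
\<close>

definition unbounded_drift ::
  "real \<Rightarrow> (real \<Rightarrow> real) \<Rightarrow> (real \<Rightarrow> real) \<Rightarrow> (real ^ 2 \<Rightarrow> real ^ 2) \<Rightarrow> real \<Rightarrow> (real \<Rightarrow> real) \<Rightarrow> real \<Rightarrow> bool" where
  "unbounded_drift \<theta>0 r1 r2 b \<Theta> m \<kappa> \<longleftrightarrow>
     \<Theta> \<ge> \<theta>0 \<and>
     (\<forall>\<theta>\<ge>\<Theta>. m \<theta> \<ge> 0) \<and>
     mono_on {\<Theta>..} m \<and>
     bounded (b ` (spiral_dom \<theta>0 r1 r2 \<inter> spiral_sector r1 r2 {\<theta>0..\<Theta>})) \<and>
     (\<forall>\<theta>\<ge>\<Theta>. \<forall>x \<in> spiral_dom \<theta>0 r1 r2 \<inter> slice r1 r2 \<theta>. norm (b x) \<le> m \<theta>) \<and>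
     filterlim m at_top at_top \<and>
     0 < \<kappa> \<and> \<kappa> < 1 \<and>
     filterlim (\<lambda>T. integral {\<Theta>..T} (\<lambda>\<theta>. \<kappa> powr m \<theta>)) at_top at_top"

text \<open>Used only for \<open>u\<close> continuous on the closed spiral, so that the supremum is finite.\<close>

definition below_exp_growth :: "(real \<Rightarrow> real) \<Rightarrow> (real \<Rightarrow> real) \<Rightarrow> (real ^ 2 \<Rightarrow> real) \<Rightarrow> bool" where
  "below_exp_growth r1 r2 u \<longleftrightarrow>
     (\<forall>\<epsilon>>0. ((\<lambda>\<theta>. exp (- \<epsilon> * \<theta>) * (SUP x\<in>slice r1 r2 \<theta>. \<bar>u x\<bar>)) \<longlongrightarrow> 0) at_top)"

end

theory Submission
  imports Defs
begin

text \<open>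
  By linearity it suffices to study \<open>w = u1 - u2\<close>, which satisfies \<open>L w = 0\<close>, vanishes on the
  spiral walls, and grows slowly.  Let \<open>M(\<theta>)\<close> be the maximum of \<open>\<bar>w\<bar>\<close> over the slice at angle
  \<open>\<theta>\<close> (\<open>slice_max\<close>).  Two facts about \<open>M\<close> carry the whole proof, and both come from one explicit
  barrier, a plane exponential \<open>g(x) = exp (\<mu> (e \<bullet> x))\<close> with a unit vector \<open>e\<close>.  Since
  \<open>L g = \<mu> g (b \<bullet> e - \<mu> (e \<bullet> A e))\<close>, it satisfies \<open>L g < 0\<close> as soon as \<open>\<mu> = (m + 1) / c0\<close>, where
  \<open>m\<close> bounds the drift.

  First, the weak maximum principle on the piece of the spiral between the angles \<open>a\<close> and \<open>T\<close>
  gives \<open>M(\<theta>) \<le> max (M(a)) (M(T))\<close> for \<open>a \<le> \<theta> \<le> T\<close> (\<open>slice_max_le_max_ends\<close>).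

  Secondly, take \<open>e = (cos \<theta>, sin \<theta>)\<close> and the piece between the angles \<open>\<theta> - \<pi>/2\<close> and
  \<open>\<theta> + \<pi>/2\<close>.  There \<open>e \<bullet> x\<close> is \<open>0\<close> on both end slices, equals the radius on the slice at \<open>\<theta>\<close>, and
  is at most the largest radius everywhere.  Comparing \<open>\<bar>w\<bar>\<close> with a constant minus a multiple of
  \<open>g\<close> shows that \<open>M(\<theta>)\<close> is at most \<open>1 - q\<close> times the larger of the values of \<open>M\<close> at the two ends,
  where \<open>q\<close> is \<open>exp (- \<mu> \<eta>)\<close> up to a constant factor and \<open>\<eta>\<close> bounds the oscillation of the radius
  on that piece (\<open>slice_max_contraction\<close>).  Because the spiral approaches a circle, \<open>\<eta>\<close> is
  arbitrarily small far along the spiral; hence \<open>q \<ge> c * \<kappa> powr m\<close> for the prescribed \<open>\<kappa>\<close>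
  (\<open>slice_max_contraction_rate\<close>).

  The rest is a statement about real functions.  If \<open>M\<close> ever exceeded an earlier value, the first
  fact would make it nondecreasing from then on, and the second would make it grow at least like
  \<open>exp (\<nu> * \<integral> \<kappa> powr m)\<close>; this is exponential growth when \<open>m\<close> is constant, and unbounded growth
  when the integral diverges, and both are excluded (\<open>contraction_imp_nonincreasing\<close>).  So \<open>M\<close>
  is nonincreasing, the larger end value in the second fact is the earlier one, and
  iterating in steps of \<open>\<pi>/2\<close> yields the decay (\<open>contraction_imp_decay\<close>).  Bounded drift is the case
  of constant \<open>m\<close>.
\<close>

section \<open>Differential calculus in the plane\<close>

lemma partial_deriv_eqI:
  assumes "(f has_derivative f') (at x)"
  shows "partial_deriv i f x = f' (axis i 1)"
  using frechet_derivative_at[OF assms] by (simp add: partial_deriv_def)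

lemma frechet_derivative_eq_gradient:
  assumes "f differentiable (at x)"
  shows "frechet_derivative f (at x) \<xi> = \<xi> \<bullet> gradient f x"
proof -
  interpret linear "frechet_derivative f (at x)"
    using linear_frechet_derivative[OF assms] .
  have "\<xi> = (\<xi> $ 1) *\<^sub>R axis 1 1 + (\<xi> $ 2) *\<^sub>R axis 2 1"
    by (simp add: vec_eq_iff forall_2 axis_def)
  then have "frechet_derivative f (at x) \<xi>
      = frechet_derivative f (at x) ((\<xi> $ 1) *\<^sub>R axis 1 1 + (\<xi> $ 2) *\<^sub>R axis 2 1)"
    by simp
  also have "\<dots> = \<xi> \<bullet> gradient f x"
    by (simp add: add scaleR inner_vec_def sum_2 gradient_def partial_deriv_def)
  finally show ?thesis .
qed

lemma partial_deriv_lincomb: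
  assumes "f differentiable (at x)" "g differentiable (at x)"
  shows "partial_deriv i (\<lambda>y. a * f y + b * g y) x = a * partial_deriv i f x + b * partial_deriv i g x"
proof -
  have "((\<lambda>y. a * f y + b * g y) has_derivative
      (\<lambda>h. a * frechet_derivative f (at x) h + b * frechet_derivative g (at x) h)) (at x)"
    using assms unfolding frechet_derivative_works by (intro derivative_intros)
  then show ?thesis
    by (subst partial_deriv_eqI) (simp_all add: partial_deriv_def)
qed

lemma C2_on_subset: "C2_on D f \<Longrightarrow> E \<subseteq> D \<Longrightarrow> C2_on E f"
  unfolding C2_on_def by (meson continuous_on_subset subsetD)

text \<open>
  The partial derivatives are functions on the whole plane, but the linear formula for them is
  available only on \<open>D\<close>; openness of \<open>D\<close> is what allows differentiating this formula once more.
\<close>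

lemma
  assumes D: "open D" and f: "C2_on D f" and g: "C2_on D g"
  shows C2_on_lincomb: "C2_on D (\<lambda>y. a * f y + b * g y)"
    and nondiv_op_lincomb: "x \<in> D \<Longrightarrow> nondiv_op A B (\<lambda>y. a * f y + b * g y) x
      = a * nondiv_op A B f x + b * nondiv_op A B g x"
proof -
  let ?h = "\<lambda>y. a * f y + b * g y"
  let ?p = "\<lambda>i y. a * partial_deriv i f y + b * partial_deriv i g y"
  have p1: "partial_deriv i ?h y = ?p i y" if "y \<in> D" for i y
    using f g that by (intro partial_deriv_lincomb) (auto simp: C2_on_def)
  have dp: "?p i differentiable (at y)" if "y \<in> D" for i y
    using f g that unfolding C2_on_def by (intro derivative_intros) auto
  have d2: "partial_deriv j (partial_deriv i ?h) y
      = a * partial_deriv j (partial_deriv i f) y + b * partial_deriv j (partial_deriv i g) y"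
    if "y \<in> D" for i j y
  proof -
    have "partial_deriv j (partial_deriv i ?h) y = partial_deriv j (?p i) y"
    proof -
      have "frechet_derivative (?p i) (at y) = frechet_derivative (partial_deriv i ?h) (at y)"
        by (rule frechet_derivative_transform_within_open[OF dp[OF that] D that]) (simp add: p1)
      then show ?thesis by (simp add: partial_deriv_def[of j])
    qed
    also have "\<dots> = a * partial_deriv j (partial_deriv i f) y + b * partial_deriv j (partial_deriv i g) y"
      using f g that by (intro partial_deriv_lincomb) (auto simp: C2_on_def)
    finally show ?thesis .
  qed
  show "C2_on D ?h"
    unfolding C2_on_def
  proof (intro conjI allI ballI)
    show "?h differentiable (at y)" if "y \<in> D" for y
      using f g that unfolding C2_on_def by (intro derivative_intros) auto
    show "partial_deriv i ?h differentiable (at y)" if "y \<in> D" for i y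
    proof -
      have "(partial_deriv i ?h has_derivative frechet_derivative (?p i) (at y)) (at y)"
        using dp[OF that] unfolding frechet_derivative_works
        by (rule has_derivative_transform_within_open[OF _ D that]) (simp add: p1)
      then show ?thesis unfolding differentiable_def by blast
    qed
    show "continuous_on D (partial_deriv i (partial_deriv j ?h))" for i j
    proof -
      have "continuous_on D (\<lambda>y. a * partial_deriv i (partial_deriv j f) y
              + b * partial_deriv i (partial_deriv j g) y)"
        using f g unfolding C2_on_def by (intro continuous_intros) auto
      then show ?thesis
        by (rule continuous_on_eq) (simp add: d2)
    qed
  qed
  assume x: "x \<in> D"
  show "nondiv_op A B ?h x = a * nondiv_op A B f x + b * nondiv_op A B g x"
    using x by (simp add: nondiv_op_def gradient_def inner_vec_def sum_2 p1 d2 algebra_simps)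
qed

section \<open>Maximum principle\<close>

text \<open>
  Restricting \<open>v\<close> to the line through \<open>x\<close> in direction \<open>\<xi>\<close> reduces the second claim to one variable:
  a positive second derivative at \<open>x\<close>, where the first one vanishes, would make the restriction
  strictly increasing to the right of \<open>x\<close>.
\<close>

lemma
  fixes v :: "real ^ 2 \<Rightarrow> real"
  assumes D: "open D" "x \<in> D" and v: "C2_on D v" and max: "\<And>y. y \<in> D \<Longrightarrow> v y \<le> v x"
  shows gradient_eq_0_at_max: "gradient v x = 0"
    and second_derivative_le_0_at_max:
      "(\<Sum>i\<in>UNIV. \<Sum>j\<in>UNIV. \<xi> $ i * \<xi> $ j * partial_deriv i (partial_deriv j v) x) \<le> 0"
proof -
  have dv: "v differentiable (at y)" if "y \<in> D" for y
    using v that by (simp add: C2_on_def)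
  have "frechet_derivative v (at x) = (\<lambda>h. 0)"
    using differential_zero_maxmin[OF D(2,1)] dv[OF D(2)] max
    unfolding frechet_derivative_works by blast
  then show g0: "gradient v x = 0"
    by (simp add: gradient_def partial_deriv_def vec_eq_iff)
  let ?l = "\<lambda>t. x + t *\<^sub>R \<xi>"
  let ?H = "\<Sum>i\<in>UNIV. \<Sum>j\<in>UNIV. \<xi> $ i * \<xi> $ j * partial_deriv i (partial_deriv j v) x"
  define G where "G t = \<xi> $ 1 * partial_deriv 1 v (?l t) + \<xi> $ 2 * partial_deriv 2 v (?l t)" for t
  obtain e where e: "e > 0" "\<And>t. \<bar>t\<bar> < e \<Longrightarrow> ?l t \<in> D"
  proof -
    have "open (?l -` D)"
      by (intro open_vimage D(1) continuous_intros)
    moreover have "0 \<in> ?l -` D" using D(2) by simp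
    ultimately obtain e where "e > 0" "ball 0 e \<subseteq> ?l -` D"
      by (meson openE)
    then show ?thesis using that[of e] by (auto simp: subset_iff dist_real_def)
  qed
  have l: "(?l has_derivative (\<lambda>s. s *\<^sub>R \<xi>)) (at t)" for t
    by (auto intro!: derivative_eq_intros)
  have chain: "((\<lambda>t. f (?l t)) has_real_derivative \<xi> \<bullet> gradient f (?l t)) (at t)"
    if "f differentiable (at (?l t))" for f :: "real ^ 2 \<Rightarrow> real" and t
  proof -
    have "(f has_derivative (\<lambda>h. h \<bullet> gradient f (?l t))) (at (?l t))"
      using that unfolding frechet_derivative_works
      by (rule has_derivative_eq_rhs) (simp add: fun_eq_iff frechet_derivative_eq_gradient[OF that])
    from has_derivative_compose[OF l this] show ?thesis
      by (simp add: has_field_derivative_def mult_commute_abs)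
  qed
  have dG: "((\<lambda>t. v (?l t)) has_real_derivative G t) (at t)" if "\<bar>t\<bar> < e" for t
    using chain[OF dv[OF e(2)[OF that]]] by (simp add: G_def inner_vec_def sum_2 gradient_def)
  have "(G has_real_derivative ?H) (at 0)"
  proof -
    have d: "((\<lambda>t. partial_deriv i v (?l t)) has_real_derivative
        \<xi> \<bullet> gradient (partial_deriv i v) x) (at 0)" for i
      using chain[of "partial_deriv i v" 0] v D(2) by (simp add: C2_on_def)
    show ?thesis
      unfolding G_def
      by (rule derivative_eq_intros d refl)+
         (simp add: sum_2 gradient_def inner_vec_def algebra_simps)
  qed
  moreover have "G 0 = 0"
    using g0 by (simp add: G_def gradient_def vec_eq_iff)
  moreover have False if H: "?H > 0" and G: "(G has_real_derivative ?H) (at 0)" "G 0 = 0"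
  proof -
    obtain d where d: "d > 0" "\<And>h. 0 < h \<Longrightarrow> h < d \<Longrightarrow> G h > 0"
      using DERIV_pos_inc_right[OF G(1) H] G(2) by auto
    define s where "s = min d e / 2"
    have s: "0 < s" "s < d" "s < e" using d(1) e(1) by (auto simp: s_def)
    have "v (?l 0) < v (?l s)"
    proof (rule DERIV_pos_imp_increasing_open[OF s(1)])
      show "\<exists>y. ((\<lambda>t. v (?l t)) has_real_derivative y) (at t) \<and> 0 < y" if "0 < t" "t < s" for t
        using dG[of t] d(2)[of t] that s by auto
      show "continuous_on {0..s} (\<lambda>t. v (?l t))"
        by (rule DERIV_continuous_on[where D=G], rule has_field_derivative_at_within, rule dG)
           (use s in auto)
    qed
    then show False using max[OF e(2)[of s]] s by auto
  qed
  ultimately show "?H \<le> 0" by fastforce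
qed

text \<open>
  At a maximum the gradient vanishes, so only the sign of the trace of \<open>A\<close> times the Hessian
  matters.  Completing the square writes the positive definite form of \<open>A\<close> as a sum of two
  squares with nonnegative weights, and hence the trace as a nonnegative combination of two second
  directional derivatives, each of which is nonpositive.
\<close>

lemma nondiv_op_nonneg_at_max:
  assumes D: "open D" "x \<in> D" and v: "C2_on D v" and max: "\<And>y. y \<in> D \<Longrightarrow> v y \<le> v x"
    and sym: "transpose (A x) = A x" and c0: "c0 > 0"
    and ell: "\<And>\<xi>. \<xi> \<bullet> (A x *v \<xi>) \<ge> c0 * (norm \<xi>)\<^sup>2"
  shows "nondiv_op A b v x \<ge> 0"
proof -
  define a11 a12 a22 where "a11 = A x $ 1 $ 1" "a12 = A x $ 1 $ 2" "a22 = A x $ 2 $ 2"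
  have a21: "A x $ 2 $ 1 = a12"
    using arg_cong[OF sym, of "\<lambda>B. B $ 2 $ 1"] by (simp add: a11_a12_a22_def transpose_def)
  have q: "a11 * s\<^sup>2 + 2 * a12 * s * t + a22 * t\<^sup>2 \<ge> c0 * (s\<^sup>2 + t\<^sup>2)" for s t
    using ell[of "vector [s, t]"] a21
    by (simp add: a11_a12_a22_def inner_vec_def sum_2 matrix_vector_mult_def norm_vec_def L2_set_def
        power2_eq_square algebra_simps)
  have a11: "a11 > 0" using q[of 1 0] c0 by simp
  \<comment> \<open>This is the form evaluated at the vector \<open>(- a12 / a11, 1)\<close>.\<close>
  have det: "a22 - a12\<^sup>2 / a11 \<ge> 0"
  proof -
    have "0 \<le> c0 * ((- a12 / a11)\<^sup>2 + 1\<^sup>2)" using c0 by simp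
    also have "\<dots> \<le> a11 * (- a12 / a11)\<^sup>2 + 2 * a12 * (- a12 / a11) * 1 + a22 * 1\<^sup>2"
      by (rule q)
    also have "\<dots> = a22 - a12\<^sup>2 / a11" using a11 by (simp add: power2_eq_square field_simps)
    finally show ?thesis .
  qed
  let ?H = "\<lambda>i j. partial_deriv i (partial_deriv j v) x"
  have H: "s\<^sup>2 * ?H 1 1 + s * t * (?H 1 2 + ?H 2 1) + t\<^sup>2 * ?H 2 2 \<le> 0" for s t
    using second_derivative_le_0_at_max[OF D v max, of "vector [s, t]"]
    by (simp add: sum_2 power2_eq_square algebra_simps)
  \<comment> \<open>The directions of the two squares are \<open>(1, a12 / a11)\<close> and \<open>(0, 1)\<close>.\<close>
  have "(\<Sum>i\<in>UNIV. \<Sum>j\<in>UNIV. A x $ i $ j * ?H i j)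
      = a11 * ?H 1 1 + a12 * (?H 1 2 + ?H 2 1) + a22 * ?H 2 2"
    using a21 by (simp add: sum_2 a11_a12_a22_def[symmetric] algebra_simps)
  also have "\<dots> = a11 * (1\<^sup>2 * ?H 1 1 + 1 * (a12 / a11) * (?H 1 2 + ?H 2 1) + (a12 / a11)\<^sup>2 * ?H 2 2)
        + (a22 - a12\<^sup>2 / a11) * (0\<^sup>2 * ?H 1 1 + 0 * 1 * (?H 1 2 + ?H 2 1) + 1\<^sup>2 * ?H 2 2)"
    using a11 by (simp add: power2_eq_square ring_distribs)
  also have "\<dots> \<le> 0"
    using mult_nonneg_nonpos[OF less_imp_le[OF a11] H[of 1 "a12 / a11"]]
      mult_nonneg_nonpos[OF det H[of 0 1]] by linarith
  finally show ?thesis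
    using gradient_eq_0_at_max[OF D v max] by (simp add: nondiv_op_def)
qed

definition plane_exp :: "real \<Rightarrow> real ^ 2 \<Rightarrow> real ^ 2 \<Rightarrow> real" where
  "plane_exp \<mu> e x = exp (\<mu> * (e \<bullet> x))"

lemma has_derivative_plane_exp [derivative_intros]:
  "(plane_exp \<mu> e has_derivative (\<lambda>h. \<mu> * (e \<bullet> h) * plane_exp \<mu> e x)) (at x)"
  unfolding plane_exp_def by (auto intro!: derivative_eq_intros)

lemma partial_deriv_plane_exp: "partial_deriv i (plane_exp \<mu> e) = (\<lambda>x. \<mu> * e $ i * plane_exp \<mu> e x)"
  by (rule ext, subst partial_deriv_eqI[OF has_derivative_plane_exp]) (simp add: inner_axis)

lemma partial_deriv_partial_deriv_plane_exp:
  "partial_deriv i (partial_deriv j (plane_exp \<mu> e)) = (\<lambda>x. \<mu>\<^sup>2 * e $ i * e $ j * plane_exp \<mu> e x)"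
proof
  fix x
  have "((\<lambda>x. \<mu> * e $ j * plane_exp \<mu> e x) has_derivative
      (\<lambda>h. \<mu> * e $ j * (\<mu> * (e \<bullet> h) * plane_exp \<mu> e x))) (at x)"
    by (intro derivative_intros)
  then show "partial_deriv i (partial_deriv j (plane_exp \<mu> e)) x = \<mu>\<^sup>2 * e $ i * e $ j * plane_exp \<mu> e x"
    unfolding partial_deriv_plane_exp[of j]
    by (simp add: partial_deriv_eqI inner_axis power2_eq_square)
qed

lemma continuous_on_plane_exp: "continuous_on D (plane_exp \<mu> e)"
  unfolding plane_exp_def by (intro continuous_intros)

lemma C2_on_plane_exp: "C2_on D (plane_exp \<mu> e)"
  unfolding C2_on_def partial_deriv_partial_deriv_plane_exp
  unfolding partial_deriv_plane_exp
proof (intro conjI allI ballI)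
  show d: "plane_exp \<mu> e differentiable (at x)" for x
    using has_derivative_plane_exp unfolding differentiable_def by blast
  show "(\<lambda>x. \<mu> * e $ i * plane_exp \<mu> e x) differentiable (at x)" for i x
    by (intro derivative_intros d)
qed (intro continuous_intros continuous_on_plane_exp)

text \<open>
  The second-order term is quadratic in the exponent and the drift term only linear, so a large
  exponent wins; the summand \<open>1\<close> gives a strict sign, also for vanishing drift.
\<close>

lemma nondiv_op_plane_exp_less_0:
  assumes "norm e = 1" and c0: "c0 > 0" and m: "m \<ge> 0"
    and ell: "\<And>\<xi>. \<xi> \<bullet> (A x *v \<xi>) \<ge> c0 * (norm \<xi>)\<^sup>2" and b: "norm (b x) \<le> m"
  shows "nondiv_op A b (plane_exp ((m + 1) / c0) e) x < 0"
proof -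
  define l where "l = (m + 1) / c0"
  have l: "l > 0" "c0 * l = m + 1" using c0 m by (auto simp: l_def)
  have "nondiv_op A b (plane_exp l e) x = plane_exp l e x * (l * (b x \<bullet> e - l * (e \<bullet> (A x *v e))))"
    unfolding nondiv_op_def partial_deriv_partial_deriv_plane_exp
    by (simp add: partial_deriv_plane_exp gradient_def inner_vec_def sum_2 matrix_vector_mult_def power2_eq_square algebra_simps)
  moreover have "b x \<bullet> e \<le> m"
    using norm_cauchy_schwarz[of "b x" e] assms(1) b by simp
  moreover have "l * (e \<bullet> (A x *v e)) \<ge> l * c0"
    using ell[of e] assms(1) l(1) by (intro mult_left_mono) auto
  ultimately show ?thesis
    using l unfolding l_def[symmetric]
    by (simp add: plane_exp_def mult_less_0_iff zero_less_mult_iff mult.commute)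
qed

text \<open>
  The coefficients are merely bounded, so no theory of solutions enters: adding a small multiple of
  a function with \<open>L g < 0\<close> makes the inequality strict, which excludes interior maxima, and then
  the multiple tends to \<open>0\<close>.
\<close>

lemma weak_maximum_principle:
  fixes v :: "real ^ 2 \<Rightarrow> real"
  assumes D: "open D" "D \<subseteq> K" "compact K" and v: "C2_on D v" "continuous_on K v"
    and c0: "c0 > 0" and m: "m \<ge> 0"
    and sym: "\<And>x. x \<in> D \<Longrightarrow> transpose (A x) = A x"
    and ell: "\<And>x \<xi>. x \<in> D \<Longrightarrow> \<xi> \<bullet> (A x *v \<xi>) \<ge> c0 * (norm \<xi>)\<^sup>2"
    and b: "\<And>x. x \<in> D \<Longrightarrow> norm (b x) \<le> m"
    and sub: "\<And>x. x \<in> D \<Longrightarrow> nondiv_op A b v x \<le> 0"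
    and bdry: "\<And>x. x \<in> K - D \<Longrightarrow> v x \<le> c"
    and x: "x \<in> K"
  shows "v x \<le> c"
proof -
  define g where "g = plane_exp ((m + 1) / c0) (axis 1 1)"
  have "compact (g ` K)"
    unfolding g_def by (intro compact_continuous_image continuous_on_plane_exp D)
  then obtain R where R: "\<And>y. y \<in> K \<Longrightarrow> g y \<le> R"
    by (meson bounded_imp_bdd_above compact_imp_bounded bdd_above.E imageI)
  have g0: "g y > 0" for y by (simp add: g_def plane_exp_def)
  have R0: "R > 0" using R[OF x] g0[of x] by linarith
  have *: "v x \<le> c + \<delta> * R" if \<delta>: "\<delta> > 0" for \<delta>
  proof -
    let ?h = "\<lambda>y. 1 * v y + \<delta> * g y"
    have "continuous_on K ?h"
      unfolding g_def by (intro continuous_intros v continuous_on_plane_exp)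
    then obtain z where z: "z \<in> K" "\<And>y. y \<in> K \<Longrightarrow> ?h y \<le> ?h z"
      using continuous_attains_sup[OF D(3)] x by blast
    \<comment> \<open>At an interior maximum \<open>L\<close> would be nonnegative, but the exponential makes it negative.\<close>
    have "z \<notin> D"
    proof
      assume zD: "z \<in> D"
      have C2: "C2_on D g" unfolding g_def by (rule C2_on_plane_exp)
      have "nondiv_op A b ?h z \<ge> 0"
        using z(2) D(2)
        by (intro nondiv_op_nonneg_at_max[where A=A, OF D(1) zD C2_on_lincomb[OF D(1) v(1) C2] _
              sym[OF zD] c0]) (auto intro: ell zD)
      moreover have "nondiv_op A b g z < 0"
        unfolding g_def by (intro nondiv_op_plane_exp_less_0 c0 m ell b zD) simp
      ultimately show False
        using sub[OF zD] \<delta> mult_pos_neg[of \<delta> "nondiv_op A b g z"]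
          nondiv_op_lincomb[OF D(1) v(1) C2 zD, of A b 1 \<delta>] by linarith
    qed
    then have "v z \<le> c" using bdry z(1) by simp
    moreover have "\<delta> * g z \<le> \<delta> * R" "\<delta> * g x > 0" using R[OF z(1)] \<delta> g0 by auto
    ultimately show ?thesis using z(2)[OF x] by simp
  qed
  show ?thesis
  proof (rule field_le_epsilon)
    fix \<epsilon> :: real
    assume "\<epsilon> > 0"
    then show "v x \<le> c + \<epsilon>" using *[of "\<epsilon> / R"] R0 by simp
  qed
qed

section \<open>Geometry of the spiral strip\<close>

lemma inner_polar: "polar s t \<bullet> polar r \<theta> = s * r * cos (\<theta> - t)"
  by (simp add: polar_def inner_vec_def sum_2 cos_diff algebra_simps)

lemma norm_polar: "norm (polar r \<theta>) = \<bar>r\<bar>"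
  by (simp add: norm_eq_sqrt_inner inner_polar)

lemma continuous_on_polar [continuous_intros]:
  fixes D :: "'a :: t2_space set"
  assumes "continuous_on D f" "continuous_on D g"
  shows "continuous_on D (\<lambda>x. polar (f x) (g x))"
proof -
  have "(\<lambda>x. polar (f x) (g x))
      = (\<lambda>x. (f x * cos (g x)) *\<^sub>R axis 1 1 + (f x * sin (g x)) *\<^sub>R axis 2 1)"
    by (auto simp: polar_def fun_eq_iff vec_eq_iff forall_2 axis_def)
  then show ?thesis by (simp only:) (intro continuous_intros assms)
qed

text \<open>
  An angular window shorter than a full turn determines the angle; this local injectivity yields
  openness of the sectors through invariance of domain.
\<close>

lemma inj_on_polar:
  assumes "\<And>r \<theta>. (r, \<theta>) \<in> V \<Longrightarrow> r > 0 \<and> \<bar>\<theta> - s\<bar> < pi"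
  shows "inj_on (\<lambda>(r, \<theta>). polar r \<theta>) V"
proof (rule inj_onI, clarify)
  fix r \<theta> r' \<theta>'
  assume V: "(r, \<theta>) \<in> V" "(r', \<theta>') \<in> V" and eq: "polar r \<theta> = polar r' \<theta>'"
  have r: "r = r'" using arg_cong[OF eq, of norm] assms[OF V(1)] assms[OF V(2)] by (simp add: norm_polar)
  have "sin \<theta> = sin \<theta>' \<and> cos \<theta> = cos \<theta>'"
    using eq assms[OF V(1)] r by (auto simp: polar_def vec_eq_iff forall_2)
  then obtain n :: int where n: "\<theta> = \<theta>' + 2 * pi * n"
    unfolding sin_cos_eq_iff by blast
  have "\<bar>2 * pi * n\<bar> < 2 * pi" using n assms[OF V(1)] assms[OF V(2)] by linarith
  then have "\<bar>real_of_int n\<bar> < 1" by (simp add: abs_mult)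
  then have "n = 0" by linarith
  with n r show "r = r' \<and> \<theta> = \<theta>'" by simp
qed

locale spiral =
  fixes \<theta>0 :: real and r1 r2 :: "real \<Rightarrow> real"
  assumes cont_r1: "continuous_on {\<theta>0..} r1" and cont_r2: "continuous_on {\<theta>0..} r2"
    and r1_pos: "\<theta> \<ge> \<theta>0 \<Longrightarrow> 0 < r1 \<theta>" and r1_less_r2: "\<theta> \<ge> \<theta>0 \<Longrightarrow> r1 \<theta> < r2 \<theta>"
begin

abbreviation "sector a T \<equiv> spiral_sector r1 r2 {a<..<T}"

abbreviation "closed_sector a T \<equiv> \<Union>\<theta>\<in>{a..T}. slice r1 r2 \<theta>"

definition slice_max :: "(real ^ 2 \<Rightarrow> real) \<Rightarrow> real \<Rightarrow> real" where
  "slice_max w \<theta> = (SUP x\<in>slice r1 r2 \<theta>. \<bar>w x\<bar>)"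

lemma open_sector:
  assumes a: "\<theta>0 \<le> a"
  shows "open (sector a T)"
proof -
  \<comment> \<open>The sector is covered by the images of the windows of half-width at most \<open>1 < \<pi>\<close>.\<close>
  define V where "V s = {(r, \<theta>). \<theta> \<in> {max a (s - 1)<..<min T (s + 1)} \<and> r1 \<theta> < r \<and> r < r2 \<theta>}" for s
  have "open ((\<lambda>(r, \<theta>). polar r \<theta>) ` V s)" for s
  proof (rule invariance_of_domain_gen)
    let ?I = "(UNIV :: real set) \<times> {max a (s - 1)<..<min T (s + 1)}"
    let ?f = "\<lambda>p. (fst p - r1 (snd p), r2 (snd p) - fst p)"
    have "open (?I \<inter> ?f -` ({0<..} \<times> {0<..}))"
    proof (rule continuous_open_preimage)
      have "continuous_on ?I (\<lambda>p. r1 (snd p))" "continuous_on ?I (\<lambda>p. r2 (snd p))"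
        using a by (auto intro!: continuous_intros continuous_on_compose2[OF cont_r1]
            continuous_on_compose2[OF cont_r2])
      then show "continuous_on ?I ?f" by (intro continuous_intros)
    qed (auto intro!: open_Times)
    moreover have "?I \<inter> ?f -` ({0<..} \<times> {0<..}) = V s"
      by (auto simp: V_def)
    ultimately show "open (V s)" by simp
    show "continuous_on (V s) (\<lambda>(r, \<theta>). polar r \<theta>)"
      unfolding case_prod_unfold by (intro continuous_intros)
    show "inj_on (\<lambda>(r, \<theta>). polar r \<theta>) (V s)"
    proof (rule inj_on_polar[where s = s])
      fix r \<theta> assume "(r, \<theta>) \<in> V s"
      then show "r > 0 \<and> \<bar>\<theta> - s\<bar> < pi"
        using a r1_pos[of \<theta>] pi_gt3 by (auto simp: V_def)
    qed
  qed simp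
  moreover have "sector a T = (\<Union>s. (\<lambda>(r, \<theta>). polar r \<theta>) ` V s)"
  proof (intro equalityI subsetI)
    fix x assume "x \<in> sector a T"
    then obtain r \<theta> where "x = polar r \<theta>" "a < \<theta>" "\<theta> < T" "r1 \<theta> < r" "r < r2 \<theta>"
      by (auto simp: spiral_sector_def)
    then have "x = (\<lambda>(r, \<theta>). polar r \<theta>) (r, \<theta>)" "(r, \<theta>) \<in> V \<theta>" by (auto simp: V_def)
    then show "x \<in> (\<Union>s. (\<lambda>(r, \<theta>). polar r \<theta>) ` V s)" by blast
  qed (auto simp: spiral_sector_def V_def)
  ultimately show ?thesis by (metis open_UN)
qed

lemma compact_closed_sector:
  assumes a: "\<theta>0 \<le> a"
  shows "compact (closed_sector a T)"
proof -
  let ?f = "\<lambda>(s, \<theta>). polar (r1 \<theta> + s * (r2 \<theta> - r1 \<theta>)) \<theta>"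
  have "closed_sector a T = ?f ` ({0..1} \<times> {a..T})"
  proof (intro equalityI subsetI)
    fix x assume "x \<in> closed_sector a T"
    then obtain r \<theta> where x: "x = polar r \<theta>" "\<theta> \<in> {a..T}" "r1 \<theta> \<le> r" "r \<le> r2 \<theta>"
      by (auto simp: slice_def)
    define s where "s = (r - r1 \<theta>) / (r2 \<theta> - r1 \<theta>)"
    have "r1 \<theta> < r2 \<theta>" using x a r1_less_r2 by auto
    then have "s * (r2 \<theta> - r1 \<theta>) = r - r1 \<theta>" "s \<in> {0..1}"
      using x by (auto simp: s_def divide_simps)
    then have "x = ?f (s, \<theta>)" "(s, \<theta>) \<in> {0..1} \<times> {a..T}"
      using x by auto
    then show "x \<in> ?f ` ({0..1} \<times> {a..T})" by blast
  next
    fix x assume "x \<in> ?f ` ({0..1} \<times> {a..T})"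
    then obtain s \<theta> where x: "x = polar (r1 \<theta> + s * (r2 \<theta> - r1 \<theta>)) \<theta>" "\<theta> \<in> {a..T}" "0 \<le> s" "s \<le> 1"
      by auto
    have "r1 \<theta> < r2 \<theta>" using x a r1_less_r2 by auto
    then have "0 \<le> s * (r2 \<theta> - r1 \<theta>)" "s * (r2 \<theta> - r1 \<theta>) \<le> 1 * (r2 \<theta> - r1 \<theta>)"
      using x by (auto intro!: mult_right_mono)
    then show "x \<in> closed_sector a T" using x by (force simp: slice_def)
  qed
  moreover have "continuous_on ({0..1} \<times> {a..T}) ?f"
    unfolding case_prod_unfold using a
    by (auto intro!: continuous_intros continuous_on_compose2[OF cont_r1] continuous_on_compose2[OF cont_r2])
  ultimately show ?thesis
    by (simp only:) (intro compact_continuous_image compact_Times compact_Icc)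
qed

lemma sector_subset_closed_sector: "sector a T \<subseteq> closed_sector a T"
  by (force simp: spiral_sector_def slice_def)

text \<open>
  The boundary on which comparison functions have to be controlled: two end slices and the walls.
\<close>

lemma closed_sector_minus_sector:
  assumes "x \<in> closed_sector a T - sector a T" "\<theta>0 \<le> a"
  shows "x \<in> slice r1 r2 a \<or> x \<in> slice r1 r2 T \<or> x \<in> spiral_walls \<theta>0 r1 r2"
proof -
  obtain r \<theta> where x: "x = polar r \<theta>" "a \<le> \<theta>" "\<theta> \<le> T" "r1 \<theta> \<le> r" "r \<le> r2 \<theta>"
    using assms(1) by (auto simp: slice_def)
  have "\<theta> = a \<or> \<theta> = T \<or> r = r1 \<theta> \<or> r = r2 \<theta>"
    using x assms(1) by (force simp: spiral_sector_def)
  then show ?thesis using x assms(2) by (auto simp: slice_def spiral_walls_def)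
qed

lemma sector_subset_dom: "\<theta>0 \<le> a \<Longrightarrow> sector a T \<subseteq> spiral_dom \<theta>0 r1 r2"
  by (force simp: spiral_sector_def spiral_dom_def)

lemma slice_subset_closed: "\<theta>0 \<le> \<theta> \<Longrightarrow> slice r1 r2 \<theta> \<subseteq> spiral_closed \<theta>0 r1 r2"
  by (auto simp: spiral_closed_def slice_def)

lemma slice_nonempty: "\<theta>0 \<le> \<theta> \<Longrightarrow> slice r1 r2 \<theta> \<noteq> {}"
  using r1_less_r2[of \<theta>] by (auto simp: slice_def)

lemma bdd_above_slice:
  fixes w :: "real ^ 2 \<Rightarrow> real"
  assumes "continuous_on (spiral_closed \<theta>0 r1 r2) w" "\<theta>0 \<le> \<theta>"
  shows "bdd_above ((\<lambda>x. \<bar>w x\<bar>) ` slice r1 r2 \<theta>)"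
proof -
  have "continuous_on (slice r1 r2 \<theta>) w"
    using assms slice_subset_closed by (blast intro: continuous_on_subset)
  then have "compact ((\<lambda>x. \<bar>w x\<bar>) ` slice r1 r2 \<theta>)"
    by (intro compact_continuous_image compact_slice continuous_on_rabs)
  then show ?thesis by (intro bounded_imp_bdd_above compact_imp_bounded)
qed

lemma abs_le_slice_max:
  assumes "continuous_on (spiral_closed \<theta>0 r1 r2) w" "\<theta>0 \<le> \<theta>" "x \<in> slice r1 r2 \<theta>"
  shows "\<bar>w x\<bar> \<le> slice_max w \<theta>"
  unfolding slice_max_def using assms by (intro cSUP_upper bdd_above_slice)

lemma slice_max_leI:
  assumes "\<theta>0 \<le> \<theta>" "\<And>x. x \<in> slice r1 r2 \<theta> \<Longrightarrow> \<bar>w x\<bar> \<le> M"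
  shows "slice_max w \<theta> \<le> M"
  unfolding slice_max_def using assms by (intro cSUP_least slice_nonempty)

lemma slice_max_nonneg:
  assumes "continuous_on (spiral_closed \<theta>0 r1 r2) w" "\<theta>0 \<le> \<theta>"
  shows "0 \<le> slice_max w \<theta>"
  using abs_le_slice_max[OF assms] slice_nonempty[OF assms(2)] by (meson abs_ge_zero equals0I order_trans)

end

section \<open>Comparison on sectors\<close>

locale spiral_elliptic = spiral +
  fixes A :: "real ^ 2 \<Rightarrow> real ^ 2 ^ 2" and b :: "real ^ 2 \<Rightarrow> real ^ 2" and c0 :: real
  assumes c0: "c0 > 0"
    and sym: "x \<in> spiral_dom \<theta>0 r1 r2 \<Longrightarrow> transpose (A x) = A x"
    and ell: "x \<in> spiral_dom \<theta>0 r1 r2 \<Longrightarrow> \<xi> \<bullet> (A x *v \<xi>) \<ge> c0 * (norm \<xi>)\<^sup>2"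
begin

text \<open>
  The properties of a difference of two solutions with equal wall data, apart from its growth.
\<close>

definition null_solution :: "(real ^ 2 \<Rightarrow> real) \<Rightarrow> bool" where
  "null_solution w \<longleftrightarrow> C2_on (spiral_dom \<theta>0 r1 r2) w \<and> continuous_on (spiral_closed \<theta>0 r1 r2) w \<and>
     (\<forall>x\<in>spiral_dom \<theta>0 r1 r2. nondiv_op A b w x = 0) \<and> (\<forall>x\<in>spiral_walls \<theta>0 r1 r2. w x = 0)"

definition drift_le :: "real \<Rightarrow> real \<Rightarrow> real \<Rightarrow> bool" where
  "drift_le m a T \<longleftrightarrow> 0 \<le> m \<and> (\<forall>x\<in>sector a T. norm (b x) \<le> m)"

text \<open>
  The weak maximum principle for \<open>w + s g\<close> and \<open>- w + s g\<close> with the exponential \<open>g\<close>.  The walls need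
  a condition on \<open>s g\<close> alone because \<open>w\<close> vanishes there.  The coefficient \<open>s = 0\<close> gives the plain
  maximum principle, a positive one the contraction estimate.
\<close>

lemma null_solution_comparison:
  assumes w: "null_solution w" and a: "\<theta>0 \<le> a" and m: "drift_le m a T"
    and e: "norm e = 1" and s: "s \<ge> 0"
    and walls: "\<And>x. x \<in> closed_sector a T \<Longrightarrow> s * plane_exp ((m + 1) / c0) e x \<le> c"
    and ends: "\<And>x. x \<in> slice r1 r2 a \<union> slice r1 r2 T \<Longrightarrow> \<bar>w x\<bar> + s * plane_exp ((m + 1) / c0) e x \<le> c"
    and x: "x \<in> closed_sector a T"
  shows "\<bar>w x\<bar> + s * plane_exp ((m + 1) / c0) e x \<le> c"
proof -
  let ?g = "plane_exp ((m + 1) / c0) e"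
  note U = sector_subset_dom[OF a, of T]
  have C2: "C2_on (sector a T) w" "C2_on (sector a T) ?g"
    using w U C2_on_plane_exp by (auto simp: null_solution_def intro: C2_on_subset)
  have main: "\<sigma> * w x + s * ?g x \<le> c" if \<sigma>: "\<bar>\<sigma>\<bar> = 1" for \<sigma> :: real
  proof (rule weak_maximum_principle[where v = "\<lambda>x. \<sigma> * w x + s * ?g x" and x = x and D = "sector a T" and K = "closed_sector a T" and m = m
        and A = A and b = b and ?c0.0 = c0])
    show "open (sector a T)" "compact (closed_sector a T)"
      by (rule open_sector[OF a]) (rule compact_closed_sector[OF a])
    show "C2_on (sector a T) (\<lambda>x. \<sigma> * w x + s * ?g x)"
      using C2 a by (intro C2_on_lincomb open_sector)
    have "closed_sector a T \<subseteq> spiral_closed \<theta>0 r1 r2"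
      using a slice_subset_closed by (meson UN_least atLeastAtMost_iff order_trans)
    then show "continuous_on (closed_sector a T) (\<lambda>x. \<sigma> * w x + s * ?g x)"
      using w by (auto simp: null_solution_def intro!: continuous_intros continuous_on_plane_exp
          intro: continuous_on_subset)
    show "nondiv_op A b (\<lambda>x. \<sigma> * w x + s * ?g x) y \<le> 0" if y: "y \<in> sector a T" for y
    proof -
      have "nondiv_op A b ?g y < 0"
        using y U m by (intro nondiv_op_plane_exp_less_0 e c0 ell) (auto simp: drift_le_def)
      moreover have "nondiv_op A b w y = 0" using w y U by (auto simp: null_solution_def)
      ultimately show ?thesis
        using s y a C2 by (simp add: nondiv_op_lincomb[OF open_sector] mult_nonneg_nonpos)
    qed
    show "\<sigma> * w y + s * ?g y \<le> c" if y: "y \<in> closed_sector a T - sector a T" for y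
    proof -
      have "\<sigma> * w y \<le> \<bar>w y\<bar>" using abs_ge_self[of "\<sigma> * w y"] \<sigma> by (simp add: abs_mult)
      then show ?thesis
        using closed_sector_minus_sector[OF y a] ends[of y] walls[of y] w y
        by (auto simp: null_solution_def)
    qed
  qed (use c0 m x U sym ell sector_subset_closed_sector in \<open>auto simp: drift_le_def\<close>)
  show ?thesis using main[of 1] main[of "-1"] by simp
qed

lemma slice_max_le_max_ends:
  assumes w: "null_solution w" and a: "\<theta>0 \<le> a" "a \<le> \<theta>" "\<theta> \<le> T" and m: "drift_le m a T"
  shows "slice_max w \<theta> \<le> max (slice_max w a) (slice_max w T)"
proof (rule slice_max_leI)
  have cw: "continuous_on (spiral_closed \<theta>0 r1 r2) w" using w by (simp add: null_solution_def)
  fix x assume x: "x \<in> slice r1 r2 \<theta>"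
  have "\<bar>w x\<bar> + 0 * plane_exp ((m + 1) / c0) (axis 1 1) x \<le> max (slice_max w a) (slice_max w T)"
  proof (rule null_solution_comparison[OF w a(1) m])
    show "x \<in> closed_sector a T" using x a by auto
  qed (use a abs_le_slice_max[OF cw] slice_max_nonneg[OF cw] in \<open>auto simp: le_max_iff_disj\<close>)
  then show "\<bar>w x\<bar> \<le> max (slice_max w a) (slice_max w T)" by simp
qed (use a in auto)

text \<open>
  The barrier is \<open>M (1 + \<beta> - \<beta> g)\<close>, where \<open>M\<close> is the larger of the two end maxima and
  \<open>g(x) = exp (\<mu> (e \<bullet> x))\<close> with \<open>e\<close> pointing in the direction \<open>\<theta>\<close>.  On the end slices \<open>e \<bullet> x = 0\<close>,
  so the barrier equals \<open>M\<close>; on the walls it is nonnegative by the choice of \<open>\<beta>\<close> as the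
  reciprocal of an upper bound for \<open>g\<close>; on the slice at \<open>\<theta>\<close> the exponent is \<open>\<mu>\<close> times the radius,
  so the barrier is strictly below \<open>M\<close> by a definite amount if \<open>lo\<close> is positive.
\<close>

lemma slice_max_contraction:
  assumes w: "null_solution w" and a: "\<theta>0 \<le> \<theta> - pi/2" and m: "drift_le m (\<theta> - pi/2) (\<theta> + pi/2)"
    and lo: "lo \<le> r1 \<theta>" and hi: "\<And>t. \<theta> - pi/2 \<le> t \<Longrightarrow> t \<le> \<theta> + pi/2 \<Longrightarrow> r2 t \<le> hi"
  defines "\<mu> \<equiv> (m + 1) / c0"
  shows "slice_max w \<theta> \<le> (1 - exp (- \<mu> * hi) * (exp (\<mu> * lo) - 1))
           * max (slice_max w (\<theta> - pi/2)) (slice_max w (\<theta> + pi/2))"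
proof (rule slice_max_leI)
  show "\<theta>0 \<le> \<theta>" using a pi_gt_zero by linarith
  have cw: "continuous_on (spiral_closed \<theta>0 r1 r2) w" using w by (simp add: null_solution_def)
  define M where "M = max (slice_max w (\<theta> - pi/2)) (slice_max w (\<theta> + pi/2))"
  define \<beta> where "\<beta> = exp (- \<mu> * hi)"
  have M: "M \<ge> 0" unfolding M_def using slice_max_nonneg[OF cw a] by (simp add: le_max_iff_disj)
  have \<mu>: "\<mu> > 0" using m c0 by (simp add: \<mu>_def drift_le_def)
  let ?e = "polar 1 \<theta>"
  fix x assume x: "x \<in> slice r1 r2 \<theta>"
  have "\<bar>w x\<bar> + (\<beta> * M) * plane_exp ((m + 1) / c0) ?e x \<le> M + \<beta> * M"
  proof (rule null_solution_comparison[OF w a m])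
    show "norm ?e = 1" by (simp add: norm_polar)
    show "0 \<le> \<beta> * M" using M by (simp add: \<beta>_def)
    show "\<beta> * M * plane_exp ((m + 1) / c0) ?e y \<le> M + \<beta> * M"
      if y: "y \<in> closed_sector (\<theta> - pi/2) (\<theta> + pi/2)" for y
    proof -
      obtain r t where t: "y = polar r t" "\<theta> - pi/2 \<le> t" "t \<le> \<theta> + pi/2" "r1 t \<le> r" "r \<le> r2 t"
        using y by (auto simp: slice_def)
      have "?e \<bullet> y \<le> norm y" using norm_cauchy_schwarz[of ?e y] by (simp add: norm_polar)
      also have "\<dots> \<le> hi" using t hi[of t] r1_pos[of t] a by (simp add: norm_polar)
      finally have "plane_exp \<mu> ?e y \<le> exp (\<mu> * hi)" using \<mu> by (simp add: plane_exp_def)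
      then have "\<beta> * plane_exp \<mu> ?e y \<le> \<beta> * exp (\<mu> * hi)" by (simp add: \<beta>_def)
      then have "\<beta> * plane_exp \<mu> ?e y \<le> 1" by (simp add: \<beta>_def flip: exp_add)
      from mult_right_mono[OF this M] have "\<beta> * M * plane_exp \<mu> ?e y \<le> M" by (simp add: mult_ac)
      moreover have "0 \<le> \<beta> * M" using M by (simp add: \<beta>_def)
      ultimately show ?thesis by (simp add: \<mu>_def)
    qed
    show "\<bar>w y\<bar> + \<beta> * M * plane_exp ((m + 1) / c0) ?e y \<le> M + \<beta> * M"
      if y: "y \<in> slice r1 r2 (\<theta> - pi/2) \<union> slice r1 r2 (\<theta> + pi/2)" for y
    proof -
      have "?e \<bullet> y = 0" using y by (auto simp: slice_def inner_polar)
      moreover have "\<bar>w y\<bar> \<le> M"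
        using y abs_le_slice_max[OF cw a, of y] abs_le_slice_max[OF cw, of "\<theta> + pi/2" y] a pi_gt_zero
        by (auto simp: M_def le_max_iff_disj)
      ultimately show ?thesis by (simp add: plane_exp_def)
    qed
    show "x \<in> closed_sector (\<theta> - pi/2) (\<theta> + pi/2)" using x by (auto intro: bexI[of _ \<theta>])
  qed
  moreover have "plane_exp \<mu> ?e x \<ge> exp (\<mu> * lo)"
    using x lo \<mu> by (auto simp: slice_def inner_polar plane_exp_def)
  then have "\<beta> * M * plane_exp \<mu> ?e x \<ge> \<beta> * M * exp (\<mu> * lo)"
    using M by (intro mult_left_mono) (auto simp: \<beta>_def)
  ultimately show "\<bar>w x\<bar> \<le> (1 - exp (- \<mu> * hi) * (exp (\<mu> * lo) - 1))
           * max (slice_max w (\<theta> - pi/2)) (slice_max w (\<theta> + pi/2))"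
    unfolding M_def[symmetric] \<beta>_def[symmetric] \<mu>_def[symmetric] by (simp add: algebra_simps)
qed

end

section \<open>Contraction between three equidistant points\<close>

lemma antimono_on_integrable:
  fixes k :: "real \<Rightarrow> real"
  assumes "antimono_on {a..} k" "a \<le> u"
  shows "k integrable_on {u..v}"
proof -
  have "mono_on {u..v} (\<lambda>t. - k t)"
    using assms by (auto simp: monotone_on_def)
  from integrable_neg[OF integrable_on_mono_on[OF this]] show ?thesis by simp
qed

text \<open>
  A rectangle over the last subinterval, with the height at its left end, bounds the integral of
  a nonincreasing function; this turns sums of contraction rates into integrals.
\<close>

lemma antimono_integral_step:
  fixes k :: "real \<Rightarrow> real"
  assumes k: "antimono_on {a..} k" and xy: "a \<le> x" "x \<le> y" "y \<le> z"
  shows "integral {x..z} k \<le> integral {x..y} k + (z - y) * k y"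
proof -
  note int = antimono_on_integrable[OF k]
  have "integral {y..z} k \<le> integral {y..z} (\<lambda>_. k y)"
    using k xy by (intro integral_le int) (auto simp: monotone_on_def)
  then have "integral {y..z} k \<le> (z - y) * k y" using xy by simp
  moreover have "integral {x..z} k = integral {x..y} k + integral {y..z} k"
    using xy by (intro Henstock_Kurzweil_Integration.integral_combine[symmetric] int) auto
  ultimately show ?thesis by simp
qed

text \<open>
  If \<open>f\<close> exceeded \<open>f a\<close> somewhere, the three-point inequality would force \<open>f\<close> to be nondecreasing
  from there on.  Then the maximum in the contraction is attained at the later point, so
  every step multiplies \<open>f\<close> by at least \<open>exp (c * k)\<close>, and the products exceed the growth that
  \<open>no_growth\<close> excludes.
\<close>

lemma contraction_imp_nonincreasing:
  fixes f k :: "real \<Rightarrow> real"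
  assumes h: "h > 0" and c: "c > 0" and t1: "\<theta>0 \<le> t1"
    and nonneg: "\<And>\<theta>. \<theta>0 \<le> \<theta> \<Longrightarrow> 0 \<le> f \<theta>"
    and quasiconvex: "\<And>a \<theta> T. \<theta>0 \<le> a \<Longrightarrow> a \<le> \<theta> \<Longrightarrow> \<theta> \<le> T \<Longrightarrow> f \<theta> \<le> max (f a) (f T)"
    and k: "antimono_on {t1..} k"
    and contr: "\<And>\<theta>. t1 + h \<le> \<theta> \<Longrightarrow> f \<theta> \<le> exp (- (c * k (\<theta> + h))) * max (f (\<theta> - h)) (f (\<theta> + h))"
    and no_growth: "\<And>s B. t1 \<le> s \<Longrightarrow> B > 0 \<Longrightarrow>
      \<exists>n. f (s + real n * h) < B * exp (c / h * integral {s + h..s + h + real n * h} k)"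
    and a: "\<theta>0 \<le> a" "a \<le> \<theta>"
  shows "f \<theta> \<le> f a"
proof (rule ccontr)
  assume "\<not> f \<theta> \<le> f a"
  then have gt: "f a < f \<theta>" by simp
  have mono: "f u \<le> f v" if "\<theta> \<le> u" "u \<le> v" for u v
    using quasiconvex[of a \<theta> u] quasiconvex[of a u v] gt a that by (auto simp: le_max_iff_disj)
  \<comment> \<open>One extra step \<open>h\<close>, so that the earlier point \<open>s - h\<close> already lies in the monotone range.\<close>
  define s where "s = max \<theta> t1 + h"
  have s: "\<theta> \<le> s - h" "t1 + h \<le> s" using h by (auto simp: s_def)
  have step: "f u * exp (c * k (u + h)) \<le> f (u + h)" if "s \<le> u" for u
  proof -
    have "f (u - h) \<le> f (u + h)" using that s h by (intro mono) auto
    then have "f u \<le> exp (- (c * k (u + h))) * f (u + h)" using contr[of u] that s by (simp add: max_def)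
    from mult_right_mono[OF this, of "exp (c * k (u + h))"] show ?thesis
      by (simp add: mult_ac flip: exp_add)
  qed
  have "f s \<ge> f \<theta>" using s h by (intro mono) auto
  then have fs: "f s > 0" using gt nonneg[OF a(1)] by linarith
  have "f s * exp (c / h * integral {s + h..s + h + real n * h} k) \<le> f (s + real n * h)" for n
  proof (induction n)
    case (Suc n)
    let ?u = "s + real n * h"
    have nh: "0 \<le> real n * h" using h by simp
    have u: "s \<le> ?u" "s + h + real n * h = ?u + h" "s + h + real (Suc n) * h = ?u + h + h"
      "s + real (Suc n) * h = ?u + h"
      using nh by (auto simp: algebra_simps)
    have "integral {s + h..?u + h + h} k \<le> integral {s + h..?u + h} k + (?u + h + h - (?u + h)) * k (?u + h)"
      using s h u nh by (intro antimono_integral_step[OF k]) auto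
    then have "c / h * integral {s + h..?u + h + h} k
        \<le> c / h * (integral {s + h..?u + h} k + h * k (?u + h))"
      using h c by (intro mult_left_mono) auto
    also have "\<dots> = c / h * integral {s + h..?u + h} k + c * k (?u + h)"
      using h by (simp add: field_simps)
    finally have "f s * exp (c / h * integral {s + h..?u + h + h} k)
        \<le> f s * exp (c / h * integral {s + h..?u + h} k + c * k (?u + h))"
      using fs by simp
    also have "\<dots> \<le> f ?u * exp (c * k (?u + h))"
      using Suc by (simp add: exp_add u(2))
    also have "\<dots> \<le> f (?u + h)" by (rule step[OF u(1)])
    finally show ?case unfolding u .
  qed simp
  moreover obtain n where "f (s + real n * h) < f s * exp (c / h * integral {s + h..s + h + real n * h} k)"
    using no_growth[of s "f s"] s h fs by auto
  ultimately show False by (meson not_le)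
qed

text \<open>
  Iterate the contraction backwards until the argument falls into the first interval of length
  \<open>h\<close> after \<open>t1\<close>.  The rate used at \<open>\<theta>\<close> is \<open>k (\<theta> + h)\<close>, and since \<open>k\<close> is nonincreasing it dominates
  the mean of \<open>k\<close> over the interval from \<open>\<theta> + h\<close> to \<open>\<theta> + 2 * h\<close>.  Starting the integral at
  \<open>t1 + 3 * h\<close> makes it empty for all starting points, so no multiplicative constant appears.
\<close>

lemma contraction_imp_decay:
  fixes f k :: "real \<Rightarrow> real"
  assumes h: "h > 0" and c: "c > 0"
    and B: "\<And>\<theta>. t1 \<le> \<theta> \<Longrightarrow> f \<theta> \<le> B" and "0 \<le> B"
    and k: "antimono_on {t1..} k" and k0: "\<And>\<theta>. t1 \<le> \<theta> \<Longrightarrow> 0 \<le> k \<theta>"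
    and contr: "\<And>\<theta>. t1 + h \<le> \<theta> \<Longrightarrow> f \<theta> \<le> exp (- (c * k (\<theta> + h))) * f (\<theta> - h)"
    and \<theta>: "t1 \<le> \<theta>"
  shows "f \<theta> \<le> B * exp (- (c / h * integral {t1 + 3 * h..\<theta> + 2 * h} k))"
proof -
  have "\<forall>\<theta>. t1 \<le> \<theta> \<and> \<theta> < t1 + (real n + 1) * h \<longrightarrow>
      f \<theta> \<le> B * exp (- (c / h * integral {t1 + 3 * h..\<theta> + 2 * h} k))" for n
  proof (induction n)
    case 0
    then show ?case using B by auto
  next
    case (Suc n)
    show ?case
    proof (intro allI impI)
      fix \<theta> assume \<theta>: "t1 \<le> \<theta> \<and> \<theta> < t1 + (real (Suc n) + 1) * h"
      show "f \<theta> \<le> B * exp (- (c / h * integral {t1 + 3 * h..\<theta> + 2 * h} k))"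
      proof (cases "\<theta> < t1 + h")
        case True
        then show ?thesis using B \<theta> by auto
      next
        case False
        have "integral {t1 + 3 * h..\<theta> + 2 * h} k \<le> integral {t1 + 3 * h..\<theta> + h} k + h * k (\<theta> + h)"
        proof (cases "\<theta> + h < t1 + 3 * h")
          case True
          have "integral {t1 + 3 * h..\<theta> + 2 * h} k
              \<le> integral {t1 + 3 * h..t1 + 3 * h} k + (\<theta> + 2 * h - (t1 + 3 * h)) * k (t1 + 3 * h)"
            using h False by (intro antimono_integral_step[OF k]) auto
          also have "\<dots> \<le> h * k (\<theta> + h)"
            using True False h \<theta> k k0[of "t1 + 3 * h"]
            by (auto simp: monotone_on_def intro!: mult_mono)
          finally show ?thesis using True by simp
        next
          case False
          then have "integral {t1 + 3 * h..\<theta> + 2 * h} k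
              \<le> integral {t1 + 3 * h..\<theta> + h} k + (\<theta> + 2 * h - (\<theta> + h)) * k (\<theta> + h)"
            using h by (intro antimono_integral_step[OF k]) auto
          then show ?thesis by simp
        qed
        then have "c / h * integral {t1 + 3 * h..\<theta> + 2 * h} k
            \<le> c / h * (integral {t1 + 3 * h..\<theta> + h} k + h * k (\<theta> + h))"
          using h c by (intro mult_left_mono) auto
        also have "\<dots> = c / h * integral {t1 + 3 * h..\<theta> + h} k + c * k (\<theta> + h)"
          using h by (simp add: field_simps)
        finally have *: "- (c * k (\<theta> + h)) + - (c / h * integral {t1 + 3 * h..\<theta> + h} k)
            \<le> - (c / h * integral {t1 + 3 * h..\<theta> + 2 * h} k)" by linarith
        have "f (\<theta> - h) \<le> B * exp (- (c / h * integral {t1 + 3 * h..\<theta> - h + 2 * h} k))"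
          using \<theta> False by (intro Suc.IH[rule_format]) (auto simp: algebra_simps)
        then have "f (\<theta> - h) \<le> B * exp (- (c / h * integral {t1 + 3 * h..\<theta> + h} k))" by (simp add: algebra_simps)
        then have "exp (- (c * k (\<theta> + h))) * f (\<theta> - h)
          \<le> exp (- (c * k (\<theta> + h))) * (B * exp (- (c / h * integral {t1 + 3 * h..\<theta> + h} k)))"
          by simp
        also have "\<dots> = B * exp (- (c * k (\<theta> + h)) + - (c / h * integral {t1 + 3 * h..\<theta> + h} k))"
          by (simp only: exp_add mult_ac)
        finally have "f \<theta> \<le> B * exp (- (c * k (\<theta> + h)) + - (c / h * integral {t1 + 3 * h..\<theta> + h} k))"
          using contr[of \<theta>] False by linarith
        also have "\<dots> \<le> B * exp (- (c / h * integral {t1 + 3 * h..\<theta> + 2 * h} k))"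
          using * \<open>0 \<le> B\<close> by (intro mult_left_mono) auto
        finally show ?thesis .
      qed
    qed
  qed
  moreover obtain n where "(\<theta> - t1) / h < real n + 1"
    by (metis add.commute less_add_one order_less_trans reals_Archimedean2)
  then have "\<theta> < t1 + (real n + 1) * h" using h by (simp add: field_simps)
  ultimately show ?thesis using \<theta> by blast
qed

section \<open>Decay along the spiral\<close>

context spiral_elliptic
begin

text \<open>
  Far along the spiral all radii lie within \<open>\<eta>\<close> of the limit radius.  The contraction then gains
  \<open>exp (- 2 * \<mu> * \<eta>)\<close> times a factor bounded away from \<open>0\<close>, because the exponents \<open>\<mu>\<close> are at least
  \<open>1 / c0\<close>.  As \<open>\<mu> = (m + 1) / c0\<close>, choosing \<open>\<eta>\<close> small compared with \<open>c0 * ln (1 / \<kappa>)\<close> makes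
  this gain at least a constant times \<open>\<kappa> powr m\<close>, with a constant that does not depend on \<open>m\<close>.
\<close>

lemma slice_max_contraction_rate:
  assumes rs: "rs > 0" "(r1 \<longlongrightarrow> rs) at_top" "(r2 \<longlongrightarrow> rs) at_top" and \<kappa>: "0 < \<kappa>" "\<kappa> < 1"
  obtains t1 c where "\<theta>0 \<le> t1" "c > 0"
    "\<And>w m \<theta>. null_solution w \<Longrightarrow> t1 + pi/2 \<le> \<theta> \<Longrightarrow> drift_le m (\<theta> - pi/2) (\<theta> + pi/2) \<Longrightarrow>
      slice_max w \<theta> \<le> exp (- (c * \<kappa> powr m)) * max (slice_max w (\<theta> - pi/2)) (slice_max w (\<theta> + pi/2))"
proof -
  define \<eta> where "\<eta> = min (rs / 2) (c0 * ln (1 / \<kappa>) / 2)"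
  have \<eta>: "\<eta> > 0" "\<eta> \<le> rs / 2" "2 * \<eta> / c0 \<le> ln (1 / \<kappa>)"
    using rs c0 \<kappa> by (auto simp: \<eta>_def field_simps min_def)
  have "eventually (\<lambda>\<theta>. rs - \<eta> < r1 \<theta>) at_top" "eventually (\<lambda>\<theta>. r2 \<theta> < rs + \<eta>) at_top"
    using order_tendstoD(1)[OF rs(2), of "rs - \<eta>"] order_tendstoD(2)[OF rs(3), of "rs + \<eta>"] \<eta> by auto
  then obtain t1 where t1: "t1 \<ge> \<theta>0" "\<And>\<theta>. \<theta> \<ge> t1 \<Longrightarrow> rs - \<eta> < r1 \<theta> \<and> r2 \<theta> < rs + \<eta>"
    unfolding eventually_at_top_linorder by (metis max.bounded_iff max.cobounded1)
  define d where "d = 1 - exp (- (rs / (2 * c0)))"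
  have d: "d > 0" using rs c0 by (simp add: d_def)
  show ?thesis
  proof
    show "\<theta>0 \<le> t1" "\<kappa> * d > 0" using t1 d \<kappa> by auto
    fix w m \<theta>
    assume w: "null_solution w" and \<theta>: "t1 + pi/2 \<le> \<theta>" and m: "drift_le m (\<theta> - pi/2) (\<theta> + pi/2)"
    have cw: "continuous_on (spiral_closed \<theta>0 r1 r2) w" using w by (simp add: null_solution_def)
    have m0: "m \<ge> 0" using m by (simp add: drift_le_def)
    define \<mu> where "\<mu> = (m + 1) / c0"
    have a: "\<theta>0 \<le> \<theta> - pi/2" "t1 \<le> \<theta>" using \<theta> t1 pi_gt_zero by linarith+
    define M where "M = max (slice_max w (\<theta> - pi/2)) (slice_max w (\<theta> + pi/2))"
    have M: "M \<ge> 0" unfolding M_def using slice_max_nonneg[OF cw a(1)] by (simp add: le_max_iff_disj)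
    have "\<mu> * (2 * \<eta>) \<le> (m + 1) * ln (1 / \<kappa>)"
      using mult_left_mono[OF \<eta>(3), of "m + 1"] m0 by (simp add: \<mu>_def mult_ac)
    then have "\<kappa> powr (m + 1) \<le> exp (- (\<mu> * (2 * \<eta>)))"
      using \<kappa> by (simp add: powr_def ln_div)
    moreover have "d \<le> 1 - exp (- (\<mu> * (rs - \<eta>)))"
    proof -
      have "1 / c0 * (rs / 2) \<le> \<mu> * (rs - \<eta>)"
        using m0 c0 \<eta> rs by (intro mult_mono) (auto simp: \<mu>_def divide_right_mono)
      then show ?thesis by (simp add: d_def field_simps)
    qed
    ultimately have "\<kappa> powr (m + 1) * d \<le> exp (- (\<mu> * (2 * \<eta>))) * (1 - exp (- (\<mu> * (rs - \<eta>))))"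
      using d by (intro mult_mono) auto
    also have "\<dots> = exp (- \<mu> * (rs + \<eta>)) * (exp (\<mu> * (rs - \<eta>)) - 1)"
    proof -
      have "exp (- (\<mu> * (2 * \<eta>))) = exp (- \<mu> * (rs + \<eta>)) * exp (\<mu> * (rs - \<eta>))"
        unfolding exp_add[symmetric] by (simp add: algebra_simps)
      moreover have "exp (\<mu> * (rs - \<eta>)) * exp (- (\<mu> * (rs - \<eta>))) = 1"
        unfolding exp_add[symmetric] by simp
      ultimately show ?thesis by (simp add: right_diff_distrib mult.assoc)
    qed
    finally have "1 - exp (- \<mu> * (rs + \<eta>)) * (exp (\<mu> * (rs - \<eta>)) - 1) \<le> 1 - \<kappa> * d * \<kappa> powr m"
      using \<kappa> by (simp add: powr_add mult_ac)
    also have "\<dots> \<le> exp (- (\<kappa> * d * \<kappa> powr m))"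
      using exp_ge_add_one_self[of "- (\<kappa> * d * \<kappa> powr m)"] by simp
    finally have "(1 - exp (- \<mu> * (rs + \<eta>)) * (exp (\<mu> * (rs - \<eta>)) - 1)) * M
        \<le> exp (- (\<kappa> * d * \<kappa> powr m)) * M"
      using M by (rule mult_right_mono)
    moreover have "slice_max w \<theta> \<le> (1 - exp (- \<mu> * (rs + \<eta>)) * (exp (\<mu> * (rs - \<eta>)) - 1)) * M"
      unfolding M_def \<mu>_def
    proof (rule slice_max_contraction[OF w a(1) m])
      show "rs - \<eta> \<le> r1 \<theta>" using t1(2)[OF a(2)] by simp
      show "r2 t \<le> rs + \<eta>" if "\<theta> - pi/2 \<le> t" for t using t1(2)[of t] \<theta> that by simp
    qed
    ultimately show "slice_max w \<theta> \<le> exp (- (\<kappa> * d * \<kappa> powr m)) *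
        max (slice_max w (\<theta> - pi/2)) (slice_max w (\<theta> + pi/2))"
      unfolding M_def by linarith
  qed
qed

text \<open>
  The growth restriction that both parts of the theorem have in common: from no starting point can
  the slice maxima keep up, at every step, with the growth that the contraction rate would
  force on a function whose maxima increase.
\<close>

definition outgrown :: "real \<Rightarrow> (real \<Rightarrow> real) \<Rightarrow> real \<Rightarrow> (real ^ 2 \<Rightarrow> real) \<Rightarrow> bool" where
  "outgrown \<nu> k \<Theta> w \<longleftrightarrow> (\<forall>s\<ge>\<Theta>. \<forall>B>0. \<exists>n. slice_max w (s + real n * (pi/2))
     < B * exp (\<nu> * integral {s + pi/2..s + pi/2 + real n * (pi/2)} k))"

text \<open>
  The interface between analysis and conclusion: \<open>\<Theta>0\<close> and \<open>\<nu>\<close> are found before \<open>w\<close>, so they depend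
  only on the spiral, the ellipticity constant \<open>c0\<close> and the drift bounds.  The contraction at \<open>\<theta>\<close>
  sees the drift up to the angle \<open>\<theta> + \<pi>/2\<close>, where \<open>m\<close> is largest.
\<close>

lemma slice_max_decay:
  assumes rs: "rs > 0" "(r1 \<longlongrightarrow> rs) at_top" "(r2 \<longlongrightarrow> rs) at_top" and \<kappa>: "0 < \<kappa>" "\<kappa> < 1"
    and \<Theta>: "\<theta>0 \<le> \<Theta>" and m: "mono_on {\<Theta>..} m"
    and drift: "\<And>a T. \<Theta> \<le> a \<Longrightarrow> a \<le> T \<Longrightarrow> drift_le (m T) a T"
    and drift_bounded: "\<And>T. \<exists>m'. drift_le m' \<theta>0 T"
  obtains \<Theta>0 \<nu> where "\<Theta> \<le> \<Theta>0" "\<nu> > 0"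
    "\<And>w a \<theta>. null_solution w \<Longrightarrow> outgrown \<nu> (\<lambda>\<theta>. \<kappa> powr m \<theta>) \<Theta> w \<Longrightarrow>
       \<theta>0 \<le> a \<Longrightarrow> a \<le> \<theta> \<Longrightarrow> slice_max w \<theta> \<le> slice_max w a"
    "\<And>w \<theta>. null_solution w \<Longrightarrow> outgrown \<nu> (\<lambda>\<theta>. \<kappa> powr m \<theta>) \<Theta> w \<Longrightarrow>
       \<Theta>0 \<le> \<theta> \<Longrightarrow>
       slice_max w \<theta> \<le> slice_max w \<theta>0 * exp (- \<nu> * integral {\<Theta>0..\<theta>} (\<lambda>\<theta>. \<kappa> powr m \<theta>))"
proof -
  define h where "h = pi / 2"
  have h: "h > 0" by (simp add: h_def)
  define k where "k = (\<lambda>\<theta>. \<kappa> powr m \<theta>)"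
  have k0: "k \<theta> \<ge> 0" for \<theta> by (simp add: k_def)
  obtain t0 c where t0: "\<theta>0 \<le> t0" "c > 0" and
    contr: "\<And>w m \<theta>. null_solution w \<Longrightarrow> t0 + h \<le> \<theta> \<Longrightarrow> drift_le m (\<theta> - h) (\<theta> + h) \<Longrightarrow>
      slice_max w \<theta> \<le> exp (- (c * \<kappa> powr m)) * max (slice_max w (\<theta> - h)) (slice_max w (\<theta> + h))"
    using slice_max_contraction_rate[OF rs \<kappa>] unfolding h_def by blast
  define t1 where "t1 = max t0 \<Theta>"
  have t1: "\<theta>0 \<le> t1" "t0 \<le> t1" "\<Theta> \<le> t1" using t0 \<Theta> by (auto simp: t1_def)
  have k: "antimono_on {t1..} k"
    using m t1 \<kappa> unfolding k_def monotone_on_def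
    by (auto intro!: powr_mono')
  have contr1: "slice_max w \<theta> \<le> exp (- (c * k (\<theta> + h))) * max (slice_max w (\<theta> - h)) (slice_max w (\<theta> + h))"
    if "null_solution w" "t1 + h \<le> \<theta>" for w \<theta>
    using contr[OF that(1), of \<theta>] that(2) t1 drift[of "\<theta> - h" "\<theta> + h"] h by (auto simp: k_def)
  have mono: "slice_max w \<theta> \<le> slice_max w a"
    if w: "null_solution w" and ng: "outgrown (c / h) k \<Theta> w" and a: "\<theta>0 \<le> a" "a \<le> \<theta>" for w a \<theta>
  proof (rule contraction_imp_nonincreasing[OF h t0(2) t1(1) _ _ k contr1[OF w] _ a])
    show "0 \<le> slice_max w \<theta>" if "\<theta>0 \<le> \<theta>" for \<theta>
      using w that by (intro slice_max_nonneg) (simp_all add: null_solution_def)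
    show "slice_max w \<theta> \<le> max (slice_max w a) (slice_max w T)" if "\<theta>0 \<le> a" "a \<le> \<theta>" "\<theta> \<le> T" for a \<theta> T
    proof -
      obtain m' where "drift_le m' \<theta>0 T" using drift_bounded by blast
      then have "drift_le m' a T" using that by (force simp: drift_le_def spiral_sector_def)
      then show ?thesis using slice_max_le_max_ends[OF w that] by blast
    qed
    show "\<exists>n. slice_max w (s + real n * h) < B * exp (c / h * integral {s + h..s + h + real n * h} k)"
      if "t1 \<le> s" "B > 0" for s B using ng that t1 by (auto simp: outgrown_def h_def)
  qed
  have decay: "slice_max w \<theta> \<le> slice_max w \<theta>0 * exp (- (c / h) * integral {t1 + 3 * h..\<theta>} k)"
    if w: "null_solution w" and ng: "outgrown (c / h) k \<Theta> w" and \<theta>: "t1 + 3 * h \<le> \<theta>" for w \<theta>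
  proof -
    have M0: "0 \<le> slice_max w \<theta>0"
      using w by (intro slice_max_nonneg) (simp_all add: null_solution_def)
    have "slice_max w \<theta> \<le> slice_max w \<theta>0 * exp (- (c / h * integral {t1 + 3 * h..\<theta> + 2 * h} k))"
    proof (rule contraction_imp_decay[OF h t0(2) _ M0 k k0])
      show "slice_max w t \<le> slice_max w \<theta>0" if "t1 \<le> t" for t
        using mono[OF w ng] t1 that by auto
      show "slice_max w t \<le> exp (- (c * k (t + h))) * slice_max w (t - h)" if "t1 + h \<le> t" for t
        using contr1[OF w that] mono[OF w ng, of "t - h" "t + h"] t1 that h by (simp add: max_def split: if_splits)
      show "t1 \<le> \<theta>" using \<theta> h by simp
    qed
    also have "\<dots> \<le> slice_max w \<theta>0 * exp (- (c / h * integral {t1 + 3 * h..\<theta>} k))"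
    proof -
      have "integral {t1 + 3 * h..\<theta>} k \<le> integral {t1 + 3 * h..\<theta> + 2 * h} k"
        using h k0 by (intro integral_subset_le antimono_on_integrable[OF k]) auto
      then have "c / h * integral {t1 + 3 * h..\<theta>} k \<le> c / h * integral {t1 + 3 * h..\<theta> + 2 * h} k"
        using t0 h by (intro mult_left_mono) auto
      then show ?thesis using M0 by (intro mult_left_mono) auto
    qed
    finally show ?thesis by simp
  qed
  show ?thesis
  proof
    show "\<Theta> \<le> t1 + 3 * h" "c / h > 0" using t1 t0 h by auto
  qed (use mono decay in \<open>auto simp: h_def k_def\<close>)
qed

lemma null_solution_diff:
  assumes "C2_on (spiral_dom \<theta>0 r1 r2) u1" "continuous_on (spiral_closed \<theta>0 r1 r2) u1"
    and "C2_on (spiral_dom \<theta>0 r1 r2) u2" "continuous_on (spiral_closed \<theta>0 r1 r2) u2"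
    and "\<And>x. x \<in> spiral_dom \<theta>0 r1 r2 \<Longrightarrow> nondiv_op A b u1 x = nondiv_op A b u2 x"
    and "\<And>x. x \<in> spiral_walls \<theta>0 r1 r2 \<Longrightarrow> u1 x = u2 x"
  shows "null_solution (\<lambda>x. u1 x - u2 x)"
proof -
  have "spiral_dom \<theta>0 r1 r2 = (\<Union>T. sector \<theta>0 T)"
  proof (intro equalityI subsetI)
    fix x assume "x \<in> spiral_dom \<theta>0 r1 r2"
    then obtain r \<theta> where "x = polar r \<theta>" "\<theta>0 < \<theta>" "r1 \<theta> < r" "r < r2 \<theta>"
      by (auto simp: spiral_dom_def)
    then have "x \<in> sector \<theta>0 (\<theta> + 1)" by (force simp: spiral_sector_def)
    then show "x \<in> (\<Union>T. sector \<theta>0 T)" by blast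
  qed (use sector_subset_dom[OF order_refl] in blast)
  then have "open (spiral_dom \<theta>0 r1 r2)" using open_sector[OF order_refl] by auto
  note this assms(1,3)
  from C2_on_lincomb[OF this, of 1 "-1"] nondiv_op_lincomb[OF this, of _ A b 1 "-1"] show ?thesis
    using assms by (auto simp: null_solution_def intro: continuous_intros)
qed

lemma slice_max_diff_le:
  assumes "continuous_on (spiral_closed \<theta>0 r1 r2) u1" "continuous_on (spiral_closed \<theta>0 r1 r2) u2" "\<theta>0 \<le> \<theta>"
  shows "slice_max (\<lambda>x. u1 x - u2 x) \<theta> \<le> slice_max u1 \<theta> + slice_max u2 \<theta>"
  using abs_le_slice_max[OF assms(1,3)] abs_le_slice_max[OF assms(2,3)]
  by (intro slice_max_leI assms) (smt (verit))

text \<open>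
  For constant \<open>k = K\<close> the forced growth is \<open>exp (\<nu> * K * \<theta>)\<close> up to a factor, which growth below
  every exponential cannot match.
\<close>

lemma outgrown_of_below_exp_growth:
  assumes cont: "continuous_on (spiral_closed \<theta>0 r1 r2) u1" "continuous_on (spiral_closed \<theta>0 r1 r2) u2"
    and growth: "below_exp_growth r1 r2 u1" "below_exp_growth r1 r2 u2"
    and \<nu>: "\<nu> > 0" and K: "K > 0" and \<Theta>: "\<theta>0 \<le> \<Theta>"
  shows "outgrown \<nu> (\<lambda>_. K) \<Theta> (\<lambda>x. u1 x - u2 x)"
  unfolding outgrown_def
proof (intro allI impI)
  fix s B :: real assume s: "\<Theta> \<le> s" and B: "0 < B"
  define \<epsilon> where "\<epsilon> = \<nu> * K"
  define L where "L \<theta> = exp (- \<epsilon> * \<theta>) * slice_max u1 \<theta> + exp (- \<epsilon> * \<theta>) * slice_max u2 \<theta>" for \<theta>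
  have \<epsilon>: "\<epsilon> > 0" using \<nu> K by (simp add: \<epsilon>_def)
  have "(L \<longlongrightarrow> 0 + 0) at_top"
    unfolding L_def slice_max_def using growth \<epsilon> unfolding below_exp_growth_def
    by (intro tendsto_add) auto
  moreover have "0 < B * exp (- \<epsilon> * s)" using B by simp
  ultimately have "eventually (\<lambda>\<theta>. L \<theta> < B * exp (- \<epsilon> * s)) at_top"
    by (intro order_tendstoD(2)) auto
  then obtain T where T: "\<And>\<theta>. T \<le> \<theta> \<Longrightarrow> L \<theta> < B * exp (- \<epsilon> * s)"
    unfolding eventually_at_top_linorder by blast
  obtain n where n: "(T - s) / (pi/2) < real n" using reals_Archimedean2 by blast
  let ?t = "s + real n * (pi/2)"
  have nh: "0 \<le> real n * (pi/2)" by simp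
  have t: "T \<le> ?t" "\<theta>0 \<le> ?t" using n nh s \<Theta> by (simp add: field_simps, linarith)
  have "slice_max (\<lambda>x. u1 x - u2 x) ?t \<le> slice_max u1 ?t + slice_max u2 ?t"
    by (rule slice_max_diff_le[OF cont t(2)])
  also have "\<dots> = exp (\<epsilon> * ?t) * L ?t"
    unfolding L_def by (simp only: distrib_left[symmetric] mult.assoc[symmetric] exp_add[symmetric]) simp
  also have "\<dots> < exp (\<epsilon> * ?t) * (B * exp (- \<epsilon> * s))" using T[OF t(1)] by simp
  also have "\<dots> = B * exp (\<epsilon> * ?t + - \<epsilon> * s)" by (simp only: exp_add mult_ac)
  also have "\<epsilon> * ?t + - \<epsilon> * s = \<nu> * integral {s + pi/2..s + pi/2 + real n * (pi/2)} (\<lambda>_. K)"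
    using nh by (simp add: \<epsilon>_def algebra_simps)
  finally show "\<exists>n. slice_max (\<lambda>x. u1 x - u2 x) (s + real n * (pi/2))
      < B * exp (\<nu> * integral {s + pi/2..s + pi/2 + real n * (pi/2)} (\<lambda>_. K))" by blast
qed

lemma outgrown_of_bounded:
  assumes w: "\<And>x. x \<in> spiral_closed \<theta>0 r1 r2 \<Longrightarrow> \<bar>w x\<bar> \<le> R"
    and \<nu>: "\<nu> > 0" and \<Theta>: "\<theta>0 \<le> \<Theta>" and k: "antimono_on {\<Theta>..} k"
    and div: "filterlim (\<lambda>T. integral {\<Theta>..T} k) at_top at_top"
  shows "outgrown \<nu> k \<Theta> w"
  unfolding outgrown_def
proof (intro allI impI)
  fix s B :: real assume s: "\<Theta> \<le> s" and B: "0 < B"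
  define R' where "R' = max R 0 + 1"
  define Z where "Z = integral {\<Theta>..s + pi/2} k + ln (R' / B) / \<nu>"
  obtain T where T: "\<And>t. T \<le> t \<Longrightarrow> Z \<le> integral {\<Theta>..t} k"
    using div unfolding filterlim_at_top eventually_at_top_linorder by blast
  obtain n where n: "(T - s) / (pi/2) < real n" using reals_Archimedean2 by blast
  let ?t = "s + pi/2 + real n * (pi/2)"
  have nh: "0 \<le> real n * (pi/2)" by simp
  have s': "\<Theta> \<le> s + pi/2" using s pi_gt_zero by linarith
  have "T < s + real n * (pi/2)" using n by (simp add: field_simps)
  then have t: "T \<le> ?t" using pi_gt_zero by linarith
  have "integral {\<Theta>..?t} k = integral {\<Theta>..s + pi/2} k + integral {s + pi/2..?t} k"
    using s' nh
    by (intro Henstock_Kurzweil_Integration.integral_combine[symmetric] antimono_on_integrable[OF k]) auto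
  with T[OF t] have "ln (R' / B) / \<nu> \<le> integral {s + pi/2..?t} k" by (simp add: Z_def)
  then have "ln (R' / B) \<le> \<nu> * integral {s + pi/2..?t} k" using \<nu> by (simp add: field_simps)
  then have "exp (ln (R' / B)) \<le> exp (\<nu> * integral {s + pi/2..?t} k)" by simp
  moreover have "R' > 0" by (simp add: R'_def)
  ultimately have "R' \<le> B * exp (\<nu> * integral {s + pi/2..?t} k)" using B by (simp add: field_simps)
  moreover have "slice_max w (s + real n * (pi/2)) \<le> R"
  proof (rule slice_max_leI)
    show "\<theta>0 \<le> s + real n * (pi/2)" using s \<Theta> nh by linarith
    then show "\<bar>w x\<bar> \<le> R" if "x \<in> slice r1 r2 (s + real n * (pi/2))" for x
      using that slice_subset_closed w by blast
  qed
  moreover have "R < R'" by (simp add: R'_def)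
  ultimately show "\<exists>n. slice_max w (s + real n * (pi/2))
      < B * exp (\<nu> * integral {s + pi/2..s + pi/2 + real n * (pi/2)} k)"
    by (intro exI[of _ n]) linarith
qed

end

section \<open>Decay of differences of solutions\<close>

theorem theorem6p1:
  fixes \<theta>0 rs :: real and r1 r2 :: "real \<Rightarrow> real"
    and A :: "real ^ 2 \<Rightarrow> real ^ 2 ^ 2" and b :: "real ^ 2 \<Rightarrow> real ^ 2"
    and U Ut \<gamma> :: "(real ^ 2) set" and S :: "real \<Rightarrow> (real ^ 2) set"
  assumes "continuous_on {\<theta>0..} r1" and "continuous_on {\<theta>0..} r2"
    and "\<And>\<theta>. \<theta> \<ge> \<theta>0 \<Longrightarrow> 0 < r1 \<theta>" and "\<And>\<theta>. \<theta> \<ge> \<theta>0 \<Longrightarrow> 0 < r2 \<theta>"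
    and "\<And>\<theta>. \<theta> \<ge> \<theta>0 \<Longrightarrow> r2 (\<theta> + 2 * pi) < r1 \<theta>"
    and "\<And>\<theta>. \<theta> \<ge> \<theta>0 \<Longrightarrow> r1 \<theta> < r2 \<theta>"
    and "rs > 0" and "(r1 \<longlongrightarrow> rs) at_top" and "(r2 \<longlongrightarrow> rs) at_top"
    and U_def: "U = spiral_dom \<theta>0 r1 r2" and Ut_def: "Ut = spiral_closed \<theta>0 r1 r2"
    and \<gamma>_def: "\<gamma> = spiral_walls \<theta>0 r1 r2" and S_def: "S = slice r1 r2"
    and "\<And>x. x \<in> U \<Longrightarrow> transpose (A x) = A x"
    and "elliptic_on U A"
  shows
    "(\<forall>M2\<ge>0. (\<forall>x\<in>U. norm (b x) \<le> M2) \<longrightarrow>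
       (\<exists>C>0. \<exists>\<nu>>0. \<forall>u1 u2.
          C2_on U u1 \<and> continuous_on Ut u1 \<and> C2_on U u2 \<and> continuous_on Ut u2 \<and>
          (\<forall>x\<in>U. nondiv_op A b u1 x = nondiv_op A b u2 x) \<and>
          (\<forall>x\<in>\<gamma>. u1 x = u2 x) \<and>
          below_exp_growth r1 r2 u1 \<and> below_exp_growth r1 r2 u2 \<longrightarrow>
          bdd_above ((\<lambda>x. \<bar>u1 x - u2 x\<bar>) ` U) \<and>
          (SUP x\<in>U. \<bar>u1 x - u2 x\<bar>) \<le> (SUP x\<in>S \<theta>0. \<bar>u1 x - u2 x\<bar>) \<and>
          (\<forall>\<theta>\<ge>\<theta>0. (SUP x\<in>S \<theta>. \<bar>u1 x - u2 x\<bar>)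
             \<le> C * (SUP x\<in>S \<theta>0. \<bar>u1 x - u2 x\<bar>) * exp (- \<nu> * (\<theta> - \<theta>0)))))
     \<and>
     (\<forall>\<Theta> m \<kappa>. unbounded_drift \<theta>0 r1 r2 b \<Theta> m \<kappa> \<longrightarrow>
       (\<exists>\<Theta>0\<ge>\<Theta>. \<exists>\<nu>>0. \<forall>u1 u2.
          C2_on U u1 \<and> continuous_on Ut u1 \<and> C2_on U u2 \<and> continuous_on Ut u2 \<and>
          (\<forall>x\<in>U. nondiv_op A b u1 x = nondiv_op A b u2 x) \<and>
          (\<forall>x\<in>\<gamma>. u1 x = u2 x) \<and>
          bounded (u1 ` Ut) \<and> bounded (u2 ` Ut) \<longrightarrow>
          (\<forall>\<theta>\<ge>\<theta>0. (SUP x\<in>S \<theta>. \<bar>u1 x - u2 x\<bar>)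
             \<le> (SUP x\<in>S \<theta>0. \<bar>u1 x - u2 x\<bar>) *
               (if \<theta> < \<Theta>0 then 1
                else min 1 (exp (- \<nu> * integral {\<Theta>0..\<theta>} (\<lambda>\<zeta>. \<kappa> powr m \<zeta>)))))))"
proof -
  obtain c0 where c0: "c0 > 0" "\<And>x \<xi>. x \<in> U \<Longrightarrow> \<xi> \<bullet> (A x *v \<xi>) \<ge> c0 * (norm \<xi>)\<^sup>2"
    using \<open>elliptic_on U A\<close> unfolding elliptic_on_def by blast
  interpret spiral_elliptic \<theta>0 r1 r2 A b c0
    using assms c0 by unfold_locales auto
  note rs = \<open>rs > 0\<close> \<open>(r1 \<longlongrightarrow> rs) at_top\<close> \<open>(r2 \<longlongrightarrow> rs) at_top\<close>
  show ?thesis (is "?bounded_drift \<and> ?unbounded_drift")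
  proof
    show ?bounded_drift
    proof (intro allI impI)
      fix M2 :: real
      assume M2: "0 \<le> M2" "\<forall>x\<in>U. norm (b x) \<le> M2"
      define K where "K = (1 / 2 :: real) powr M2"
      have K: "K > 0" by (simp add: K_def)
      have drift: "drift_le M2 a T" if "\<theta>0 \<le> a" for a T
        using M2 sector_subset_dom[OF that] by (auto simp: drift_le_def U_def)
      have drift_bounded: "\<exists>m'. drift_le m' \<theta>0 T" for T using drift by blast
      have const: "mono_on {\<theta>0..} (\<lambda>_. M2)" by (simp add: monotone_on_def)
      obtain \<Theta>0 \<nu> where \<Theta>0: "\<theta>0 \<le> \<Theta>0" "\<nu> > 0"
        and mono: "\<And>w a \<theta>. null_solution w \<Longrightarrow> outgrown \<nu> (\<lambda>_. K) \<theta>0 w \<Longrightarrow>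
          \<theta>0 \<le> a \<Longrightarrow> a \<le> \<theta> \<Longrightarrow> slice_max w \<theta> \<le> slice_max w a"
        and decay: "\<And>w \<theta>. null_solution w \<Longrightarrow> outgrown \<nu> (\<lambda>_. K) \<theta>0 w \<Longrightarrow> \<Theta>0 \<le> \<theta> \<Longrightarrow>
          slice_max w \<theta> \<le> slice_max w \<theta>0 * exp (- \<nu> * integral {\<Theta>0..\<theta>} (\<lambda>_. K))"
        using slice_max_decay[OF rs _ _ order_refl const drift drift_bounded, of "1/2"]
        unfolding K_def by auto
      define \<epsilon> where "\<epsilon> = \<nu> * K"
      have \<epsilon>: "\<epsilon> > 0" using \<Theta>0 K by (simp add: \<epsilon>_def)
      show "\<exists>C>0. \<exists>\<nu>>0. \<forall>u1 u2.
          C2_on U u1 \<and> continuous_on Ut u1 \<and> C2_on U u2 \<and> continuous_on Ut u2 \<and>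
          (\<forall>x\<in>U. nondiv_op A b u1 x = nondiv_op A b u2 x) \<and>
          (\<forall>x\<in>\<gamma>. u1 x = u2 x) \<and>
          below_exp_growth r1 r2 u1 \<and> below_exp_growth r1 r2 u2 \<longrightarrow>
          bdd_above ((\<lambda>x. \<bar>u1 x - u2 x\<bar>) ` U) \<and>
          (SUP x\<in>U. \<bar>u1 x - u2 x\<bar>) \<le> (SUP x\<in>S \<theta>0. \<bar>u1 x - u2 x\<bar>) \<and>
          (\<forall>\<theta>\<ge>\<theta>0. (SUP x\<in>S \<theta>. \<bar>u1 x - u2 x\<bar>)
             \<le> C * (SUP x\<in>S \<theta>0. \<bar>u1 x - u2 x\<bar>) * exp (- \<nu> * (\<theta> - \<theta>0)))"
      proof (intro exI conjI allI impI)
        show "exp (\<epsilon> * (\<Theta>0 - \<theta>0)) > 0" "\<epsilon> > 0" using \<epsilon> by auto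
        fix u1 u2
        assume u: "C2_on U u1 \<and> continuous_on Ut u1 \<and> C2_on U u2 \<and> continuous_on Ut u2 \<and>
          (\<forall>x\<in>U. nondiv_op A b u1 x = nondiv_op A b u2 x) \<and>
          (\<forall>x\<in>\<gamma>. u1 x = u2 x) \<and>
          below_exp_growth r1 r2 u1 \<and> below_exp_growth r1 r2 u2"
        let ?w = "\<lambda>x. u1 x - u2 x"
        have w: "null_solution ?w"
          using u by (intro null_solution_diff) (auto simp: U_def Ut_def \<gamma>_def)
        have out: "outgrown \<nu> (\<lambda>_. K) \<theta>0 ?w"
          using u K \<Theta>0 by (intro outgrown_of_below_exp_growth) (auto simp: Ut_def)
        have cw: "continuous_on (spiral_closed \<theta>0 r1 r2) ?w" using w by (simp add: null_solution_def)
        have M0: "0 \<le> slice_max ?w \<theta>0" by (rule slice_max_nonneg[OF cw order_refl])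
        have le: "\<bar>u1 x - u2 x\<bar> \<le> slice_max ?w \<theta>0" if x: "x \<in> U" for x
        proof -
          obtain r \<theta> where p: "x = polar r \<theta>" "\<theta>0 < \<theta>" "r1 \<theta> < r" "r < r2 \<theta>"
            using x by (auto simp: U_def spiral_dom_def)
          then have \<theta>: "\<theta>0 \<le> \<theta>" "x \<in> slice r1 r2 \<theta>" by (auto simp: slice_def)
          show ?thesis
            using abs_le_slice_max[OF cw \<theta>] mono[OF w out order_refl \<theta>(1)] by linarith
        qed
        then show "bdd_above ((\<lambda>x. \<bar>u1 x - u2 x\<bar>) ` U)" by (auto simp: bdd_above_def)
        have "polar ((r1 (\<theta>0 + 1) + r2 (\<theta>0 + 1)) / 2) (\<theta>0 + 1) \<in> U"
          using r1_less_r2[of "\<theta>0 + 1"] by (force simp: U_def spiral_dom_def)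
        then show "(SUP x\<in>U. \<bar>u1 x - u2 x\<bar>) \<le> (SUP x\<in>S \<theta>0. \<bar>u1 x - u2 x\<bar>)"
          using le unfolding slice_max_def S_def by (intro cSUP_least) auto
        fix \<theta> assume \<theta>: "\<theta>0 \<le> \<theta>"
        have "slice_max ?w \<theta> \<le> slice_max ?w \<theta>0 * exp (\<epsilon> * (\<Theta>0 - \<theta>))"
        proof (cases "\<Theta>0 \<le> \<theta>")
          case True
          then show ?thesis using decay[OF w out True] by (simp add: \<epsilon>_def algebra_simps)
        next
          \<comment> \<open>Before \<open>\<Theta>0\<close> only monotonicity is available; the constant \<open>C\<close> absorbs the missing decay.\<close>
          case False
          then have "slice_max ?w \<theta>0 * 1 \<le> slice_max ?w \<theta>0 * exp (\<epsilon> * (\<Theta>0 - \<theta>))"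
            using M0 \<epsilon> by (intro mult_left_mono) auto
          then show ?thesis using mono[OF w out order_refl \<theta>] by linarith
        qed
        also have "exp (\<epsilon> * (\<Theta>0 - \<theta>)) = exp (\<epsilon> * (\<Theta>0 - \<theta>0)) * exp (- \<epsilon> * (\<theta> - \<theta>0))"
          unfolding exp_add[symmetric] by (simp add: algebra_simps)
        finally show "(SUP x\<in>S \<theta>. \<bar>u1 x - u2 x\<bar>)
            \<le> exp (\<epsilon> * (\<Theta>0 - \<theta>0)) * (SUP x\<in>S \<theta>0. \<bar>u1 x - u2 x\<bar>) * exp (- \<epsilon> * (\<theta> - \<theta>0))"
          by (simp add: slice_max_def S_def mult_ac)
      qed
    qed
    show ?unbounded_drift
    proof (intro allI impI)
      fix \<Theta> m \<kappa>
      assume ub: "unbounded_drift \<theta>0 r1 r2 b \<Theta> m \<kappa>"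
      then have \<Theta>: "\<theta>0 \<le> \<Theta>" and m: "\<And>\<theta>. \<Theta> \<le> \<theta> \<Longrightarrow> 0 \<le> m \<theta>" "mono_on {\<Theta>..} m"
        and bm: "\<And>\<theta> x. \<Theta> \<le> \<theta> \<Longrightarrow> x \<in> U \<Longrightarrow> x \<in> slice r1 r2 \<theta> \<Longrightarrow> norm (b x) \<le> m \<theta>"
        and \<kappa>: "0 < \<kappa>" "\<kappa> < 1"
        and div: "filterlim (\<lambda>T. integral {\<Theta>..T} (\<lambda>\<theta>. \<kappa> powr m \<theta>)) at_top at_top"
        by (auto simp: unbounded_drift_def U_def)
      have "bounded (b ` (U \<inter> spiral_sector r1 r2 {\<theta>0..\<Theta>}))"
        using ub by (simp add: unbounded_drift_def U_def)
      then obtain R where R: "\<And>x. x \<in> U \<Longrightarrow> x \<in> spiral_sector r1 r2 {\<theta>0..\<Theta>} \<Longrightarrow> norm (b x) \<le> R"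
        unfolding bounded_iff by blast
      have b_le: "norm (b (polar r \<theta>)) \<le> m T"
        if "\<Theta> \<le> \<theta>" "\<theta> \<le> T" "r1 \<theta> < r" "r < r2 \<theta>" "polar r \<theta> \<in> U" for r \<theta> T
      proof -
        have "norm (b (polar r \<theta>)) \<le> m \<theta>"
          using that by (intro bm) (auto simp: slice_def)
        also have "\<dots> \<le> m T" using that m(2) by (auto simp: monotone_on_def)
        finally show ?thesis .
      qed
      have drift: "drift_le (m T) a T" if "\<Theta> \<le> a" "a \<le> T" for a T
        unfolding drift_le_def
      proof (intro conjI ballI)
        show "0 \<le> m T" using m(1) that by auto
        fix x assume x: "x \<in> sector a T"
        moreover have "x \<in> U" using x sector_subset_dom[of a T] that \<Theta> by (auto simp: U_def)
        ultimately show "norm (b x) \<le> m T"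
          using that b_le by (auto simp: spiral_sector_def)
      qed
      have drift_bounded: "\<exists>m'. drift_le m' \<theta>0 T" for T
      proof
        show "drift_le (max R (m (max T \<Theta>))) \<theta>0 T"
          unfolding drift_le_def
        proof (intro conjI ballI)
          show "0 \<le> max R (m (max T \<Theta>))" using m(1)[of "max T \<Theta>"] by simp
          fix x assume x: "x \<in> sector \<theta>0 T"
          then obtain r \<theta> where p: "x = polar r \<theta>" "\<theta>0 < \<theta>" "\<theta> < T" "r1 \<theta> < r" "r < r2 \<theta>"
            by (auto simp: spiral_sector_def)
          have xU: "x \<in> U" using x sector_subset_dom[of \<theta>0 T] by (auto simp: U_def)
          show "norm (b x) \<le> max R (m (max T \<Theta>))"
          proof (cases "\<theta> \<le> \<Theta>")
            case True
            then have "x \<in> spiral_sector r1 r2 {\<theta>0..\<Theta>}" using p by (force simp: spiral_sector_def)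
            then show ?thesis using R[OF xU] by simp
          next
            case False
            then show ?thesis using b_le[of \<theta> "max T \<Theta>" r] p xU by simp
          qed
        qed
      qed
      let ?k = "\<lambda>\<theta>. \<kappa> powr m \<theta>"
      have k: "antimono_on {\<Theta>..} ?k"
        using m \<kappa> unfolding monotone_on_def by (auto intro!: powr_mono')
      obtain \<Theta>0 \<nu> where \<Theta>0: "\<Theta> \<le> \<Theta>0" "\<nu> > 0"
        and mono: "\<And>w a \<theta>. null_solution w \<Longrightarrow> outgrown \<nu> ?k \<Theta> w \<Longrightarrow>
          \<theta>0 \<le> a \<Longrightarrow> a \<le> \<theta> \<Longrightarrow> slice_max w \<theta> \<le> slice_max w a"
        and decay: "\<And>w \<theta>. null_solution w \<Longrightarrow> outgrown \<nu> ?k \<Theta> w \<Longrightarrow> \<Theta>0 \<le> \<theta> \<Longrightarrow>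
          slice_max w \<theta> \<le> slice_max w \<theta>0 * exp (- \<nu> * integral {\<Theta>0..\<theta>} ?k)"
        using slice_max_decay[OF rs \<kappa> \<Theta> m(2) drift drift_bounded] by blast
      show "\<exists>\<Theta>0\<ge>\<Theta>. \<exists>\<nu>>0. \<forall>u1 u2.
          C2_on U u1 \<and> continuous_on Ut u1 \<and> C2_on U u2 \<and> continuous_on Ut u2 \<and>
          (\<forall>x\<in>U. nondiv_op A b u1 x = nondiv_op A b u2 x) \<and>
          (\<forall>x\<in>\<gamma>. u1 x = u2 x) \<and>
          bounded (u1 ` Ut) \<and> bounded (u2 ` Ut) \<longrightarrow>
          (\<forall>\<theta>\<ge>\<theta>0. (SUP x\<in>S \<theta>. \<bar>u1 x - u2 x\<bar>)
             \<le> (SUP x\<in>S \<theta>0. \<bar>u1 x - u2 x\<bar>) *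
               (if \<theta> < \<Theta>0 then 1
                else min 1 (exp (- \<nu> * integral {\<Theta>0..\<theta>} (\<lambda>\<zeta>. \<kappa> powr m \<zeta>)))))"
      proof (intro exI conjI allI impI)
        show "\<Theta> \<le> \<Theta>0" "\<nu> > 0" by fact+
        fix u1 u2 \<theta>
        assume u: "C2_on U u1 \<and> continuous_on Ut u1 \<and> C2_on U u2 \<and> continuous_on Ut u2 \<and>
          (\<forall>x\<in>U. nondiv_op A b u1 x = nondiv_op A b u2 x) \<and>
          (\<forall>x\<in>\<gamma>. u1 x = u2 x) \<and> bounded (u1 ` Ut) \<and> bounded (u2 ` Ut)"
          and \<theta>: "\<theta>0 \<le> \<theta>"
        let ?w = "\<lambda>x. u1 x - u2 x"
        have w: "null_solution ?w"
          using u by (intro null_solution_diff) (auto simp: U_def Ut_def \<gamma>_def)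
        have "bounded (u1 ` Ut)" "bounded (u2 ` Ut)" using u by auto
        then obtain R1 R2 where R12: "\<And>x. x \<in> Ut \<Longrightarrow> \<bar>u1 x\<bar> \<le> R1" "\<And>x. x \<in> Ut \<Longrightarrow> \<bar>u2 x\<bar> \<le> R2"
          unfolding bounded_iff by auto
        have "\<bar>?w x\<bar> \<le> R1 + R2" if "x \<in> spiral_closed \<theta>0 r1 r2" for x
          using R12[of x] that by (simp add: Ut_def)
        then have out: "outgrown \<nu> ?k \<Theta> ?w"
          using \<Theta>0(2) \<Theta> k div by (rule outgrown_of_bounded)
        show "(SUP x\<in>S \<theta>. \<bar>u1 x - u2 x\<bar>) \<le> (SUP x\<in>S \<theta>0. \<bar>u1 x - u2 x\<bar>) *
               (if \<theta> < \<Theta>0 then 1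
                else min 1 (exp (- \<nu> * integral {\<Theta>0..\<theta>} (\<lambda>\<zeta>. \<kappa> powr m \<zeta>))))"
          using mono[OF w out order_refl \<theta>] decay[OF w out, of \<theta>]
          by (simp add: slice_max_def S_def min_def)
      qed
    qed
  qed
qed

end
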